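(* Let $p>3$ be a prime with $\big(\frac p{31}\big)=1$. Then $$\sum_{k=0}^{[p/3]}\binom{3k}k(-1)^k\equiv\begin{cases}1\pmod p&\text{if }p=x^2+xy+70y^2,\ 9x^2+9xy+10y^2\text{ or }8x^2+3xy+9y^2,\\ (15x-14y)/(31y)\pmod p&\text{if }p=5x^2+xy+14y^2\neq5,\\ (21x-14y)/(31y)\pmod p&\text{if }p=7x^2+xy+10y^2\neq7,\\ (57x-8y)/(31y)\pmod p&\text{if }p=19x^2+5xy+4y^2\neq19,\\ -(105x+17y)/(31y)\pmod p&\text{if }p=35x^2+xy+2y^2,\end{cases}$$ where in each case $x,y\in\mathbb Z$.
   Context: $[x]$ is the greatest integer not exceeding $x$; $\big(\frac{\cdot}{\cdot}\big)$ is the Legendre symbol. Quotients are interpreted modulo $p$. *)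

theory Defs
  imports "HOL-Number_Theory.Number_Theory" "HOL-Number_Theory.Modular_Inverse"
begin

text \<open>
  The congruence \<open>s \<equiv> a / b (mod m)\<close>, with the quotient interpreted modulo \<open>m\<close>. Coprimality of the
  denominator with \<open>m\<close> is part of the assertion, because \<^const>\<open>modular_inverse\<close> has the junk
  value \<open>0\<close> for non-invertible arguments.
\<close>
definition cong_quotient :: "int \<Rightarrow> int \<Rightarrow> int \<Rightarrow> int \<Rightarrow> bool" where
  "cong_quotient s a b m \<longleftrightarrow> coprime b m \<and> [s = a * modular_inverse m b] (mod m)"

end

theory Submission
  imports Defs "HOL-Computational_Algebra.Polynomial"
begin

text \<open>
  Modulo \<open>p\<close> the sum is the value at 27 of the Morgan-Voyce polynomial of index \<open>\<lfloor>p/3\<rfloor>\<close>, that is,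
  a term of the Lucas-type sequence with characteristic polynomial \<open>t\<^sup>2 - 29 t + 1\<close>. If \<open>p\<close> is
  represented by the form \<open>A X\<^sup>2 + B X Y + C Y\<^sup>2\<close> of discriminant \<open>-279\<close>, then the roots of this
  polynomial in \<open>\<int>[\<omega>]/p\<close> are the quotients of \<open>z = A X + (B - 9)/2 Y - 9 Y \<omega>\<close> and its conjugate, so
  the sum is determined by the cubic residue symbol of \<open>z\<close> modulo \<open>p\<close>. By cubic reciprocity this is
  \<open>(p/z)\<^sub>3\<close>, and since the norm of \<open>z\<close> is \<open>A p - 9 Y\<^sup>2\<close>, it is the inverse of \<open>(A/z)\<^sub>3\<close>, which is found
  by reciprocity once more.

  Reciprocity between rational primes and Eisenstein integers is obtained from cubic Gauss sums,
  taken in the group ring \<open>\<int>[\<omega>][X]/(X\<^sup>q - 1)\<close> instead of a cyclotomic field. Unique factorisation in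
  \<open>\<int>[\<omega>]\<close> is not needed: a Jacobi sum of norm \<open>q\<close> or its conjugate splits off whenever a split prime
  \<open>q\<close> divides the norm.
\<close>

section \<open>Congruences modulo ideals\<close>

(* Confined to this block because the simp rules of the interpretation loop with those for rings. *)
context
begin

interpretation ideal: Modules.module "(*) :: 'a :: comm_ring_1 \<Rightarrow> 'a \<Rightarrow> 'a"
  by unfold_locales (simp_all add: algebra_simps)

definition ideal_cong :: "'a :: comm_ring_1 set \<Rightarrow> 'a \<Rightarrow> 'a \<Rightarrow> bool" where
  "ideal_cong S x y \<longleftrightarrow> x - y \<in> ideal.span S"

abbreviation ideal_cong_notation :: "'a :: comm_ring_1 \<Rightarrow> 'a \<Rightarrow> 'a set \<Rightarrow> bool"
    (\<open>(\<open>indent=1 notation=\<open>mixfix ideal_cong\<close>\<close>[_ = _] '(' ideal _'))\<close>)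
  where "[x = y] (ideal S) \<equiv> ideal_cong S x y"

lemma ideal_cong_refl [simp]: "[x = x] (ideal S)"
  by (simp add: ideal_cong_def ideal.span_zero)

lemma ideal_cong_sym: "[x = y] (ideal S) \<Longrightarrow> [y = x] (ideal S)"
  unfolding ideal_cong_def by (drule ideal.span_neg) simp

lemma ideal_cong_trans [trans]: "[x = y] (ideal S) \<Longrightarrow> [y = z] (ideal S) \<Longrightarrow> [x = z] (ideal S)"
  unfolding ideal_cong_def by (drule (1) ideal.span_add) simp

lemma ideal_cong_add:
  "[x = y] (ideal S) \<Longrightarrow> [x' = y'] (ideal S) \<Longrightarrow> [x + x' = y + y'] (ideal S)"
  unfolding ideal_cong_def by (drule (1) ideal.span_add) (simp add: algebra_simps)

lemma ideal_cong_diff: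
  "[x = y] (ideal S) \<Longrightarrow> [x' = y'] (ideal S) \<Longrightarrow> [x - x' = y - y'] (ideal S)"
  unfolding ideal_cong_def by (drule (1) ideal.span_diff) (simp add: algebra_simps)

lemma ideal_cong_mult_left: "[x = y] (ideal S) \<Longrightarrow> [c * x = c * y] (ideal S)"
  unfolding ideal_cong_def by (drule ideal.span_scale[of _ _ c]) (simp add: algebra_simps)

lemma ideal_cong_mult_right: "[x = y] (ideal S) \<Longrightarrow> [x * c = y * c] (ideal S)"
  using ideal_cong_mult_left[of S x y c] by (simp add: mult.commute)

lemma ideal_cong_mult:
  "[x = y] (ideal S) \<Longrightarrow> [x' = y'] (ideal S) \<Longrightarrow> [x * x' = y * y'] (ideal S)"
  by (rule ideal_cong_trans[OF ideal_cong_mult_left ideal_cong_mult_right])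

lemma ideal_cong_power: "[x = y] (ideal S) \<Longrightarrow> [x ^ n = y ^ n] (ideal S)"
  by (induction n) (simp_all add: ideal_cong_mult)

lemma ideal_cong_sum:
  "(\<And>a. a \<in> A \<Longrightarrow> [f a = g a] (ideal S)) \<Longrightarrow> [sum f A = sum g A] (ideal S)"
  unfolding ideal_cong_def sum_subtractf [symmetric] by (rule ideal.span_sum)

lemma ideal_cong_singleton_iff: "[x = y] (ideal {d}) \<longleftrightarrow> d dvd x - y"
  by (auto simp: ideal_cong_def ideal.span_singleton dvd_def mult.commute)

lemma ideal_cong_dvdI:
  assumes "d dvd x - y" and "d \<in> S"
  shows "[x = y] (ideal S)"
proof -
  obtain c where "x - y = c * d" using assms(1) by (metis dvdE mult.commute)
  then show ?thesis
    unfolding ideal_cong_def using ideal.span_scale[OF ideal.span_base[OF assms(2)]] by simp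
qed

lemma ideal_cong_pair_iff: "[x = y] (ideal {a, b}) \<longleftrightarrow> (\<exists>u v. x - y = a * u + b * v)"
  unfolding ideal_cong_def ideal.span_insert ideal.span_singleton
  by (auto simp: diff_eq_eq mult.commute add.commute)

end

lemma ideal_cong_add_power_prime:
  assumes "prime p" and "of_nat p \<in> S"
  shows "[(x + y) ^ p = x ^ p + y ^ p] (ideal S)"
proof (rule ideal_cong_dvdI)
  let ?t = "\<lambda>k. of_nat (p choose k) * x ^ k * y ^ (p - k)"
  have "p > 0" using assms(1) by (simp add: prime_gt_0_nat)
  then have "{..p} = insert 0 (insert p {0<..<p})" by auto
  then have "(x + y) ^ p - (x ^ p + y ^ p) = (\<Sum>k\<in>{0<..<p}. ?t k)"
    using \<open>p > 0\<close> by (simp add: binomial_ring[of x y p])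
  also have "of_nat p dvd \<dots>"
  proof (rule dvd_sum)
    fix k assume "k \<in> {0<..<p}"
    then have "p dvd p choose k" using assms(1) by (intro dvd_choose_prime) auto
    then show "of_nat p dvd ?t k" by (auto elim!: dvdE)
  qed
  finally show "of_nat p dvd (x + y) ^ p - (x ^ p + y ^ p)" .
qed fact

lemma ideal_cong_add_power_prime_power:
  assumes "prime p" and "of_nat p \<in> S"
  shows "[(x + y) ^ (p ^ j) = x ^ (p ^ j) + y ^ (p ^ j)] (ideal S)"
proof (induction j)
  case (Suc j)
  have "(x + y) ^ (p ^ Suc j) = ((x + y) ^ (p ^ j)) ^ p"
    by (simp add: mult.commute flip: power_mult)
  also have "[\<dots> = (x ^ (p ^ j) + y ^ (p ^ j)) ^ p] (ideal S)"
    by (rule ideal_cong_power) fact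
  also have "[\<dots> = (x ^ (p ^ j)) ^ p + (y ^ (p ^ j)) ^ p] (ideal S)"
    by (rule ideal_cong_add_power_prime) fact+
  finally show ?case by (simp add: mult.commute flip: power_mult)
qed simp

lemma ideal_cong_sum_power_prime_power:
  assumes "prime p" and "of_nat p \<in> S"
  shows "[sum f A ^ (p ^ j) = (\<Sum>a\<in>A. f a ^ (p ^ j))] (ideal S)"
proof (induction A rule: infinite_finite_induct)
  case (insert a A)
  have "[(f a + sum f A) ^ (p ^ j) = f a ^ (p ^ j) + sum f A ^ (p ^ j)] (ideal S)"
    by (rule ideal_cong_add_power_prime_power) fact+
  also have "[\<dots> = f a ^ (p ^ j) + (\<Sum>a\<in>A. f a ^ (p ^ j))] (ideal S)"
    by (intro ideal_cong_add ideal_cong_refl insert.IH)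
  finally show ?case using insert.hyps by simp
qed (use assms(1) in \<open>auto simp: power_0_left\<close>)

section \<open>Eisenstein integers\<close>

text \<open>\<open>Eis a b\<close> stands for \<open>a + b \<omega>\<close>, where \<open>\<omega>\<close> is a primitive cube root of unity.\<close>

datatype eis = Eis (eis_fst: int) (eis_snd: int)

instantiation eis :: idom
begin

definition "0 = Eis 0 0"
definition "1 = Eis 1 0"
definition "x + y = Eis (eis_fst x + eis_fst y) (eis_snd x + eis_snd y)"
definition "x - y = Eis (eis_fst x - eis_fst y) (eis_snd x - eis_snd y)"
definition "- x = Eis (- eis_fst x) (- eis_snd x)"
definition "x * y = Eis (eis_fst x * eis_fst y - eis_snd x * eis_snd y)
  (eis_fst x * eis_snd y + eis_snd x * eis_fst y - eis_snd x * eis_snd y)"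

lemmas eis_defs = zero_eis_def one_eis_def plus_eis_def minus_eis_def uminus_eis_def times_eis_def

lemma eis_norm_form_eq_0_iff:
  fixes a b :: int
  shows "a\<^sup>2 - a * b + b\<^sup>2 = 0 \<longleftrightarrow> a = 0 \<and> b = 0"
proof
  assume "a\<^sup>2 - a * b + b\<^sup>2 = 0"
  then have "(2 * a - b)\<^sup>2 + 3 * b\<^sup>2 = 0"
    by (simp add: power2_eq_square algebra_simps)
  moreover have "(2 * a - b)\<^sup>2 \<ge> 0" "b\<^sup>2 \<ge> 0" by simp_all
  ultimately have "(2 * a - b)\<^sup>2 = 0" "b\<^sup>2 = 0" by linarith+
  then show "a = 0 \<and> b = 0" by simp
qed simp

instance
proof
  fix x y z :: eis
  show "x * y * z = x * (y * z)" by (simp add: eis_defs algebra_simps)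
  show "(x + y) * z = x * z + y * z" by (simp add: eis_defs algebra_simps)
  assume nz: "x \<noteq> 0" "y \<noteq> 0"
  obtain a b c d where xy: "x = Eis a b" "y = Eis c d" by (meson eis.exhaust)
  show "x * y \<noteq> 0"
  proof
    assume "x * y = 0"
    then have "a * c - b * d = 0 \<and> a * d + b * c - b * d = 0" by (simp add: eis_defs xy)
    then have "(a * c - b * d)\<^sup>2 - (a * c - b * d) * (a * d + b * c - b * d)
        + (a * d + b * c - b * d)\<^sup>2 = 0"
      by (simp only: eis_norm_form_eq_0_iff)
    also have "(a * c - b * d)\<^sup>2 - (a * c - b * d) * (a * d + b * c - b * d)
        + (a * d + b * c - b * d)\<^sup>2 = (a\<^sup>2 - a * b + b\<^sup>2) * (c\<^sup>2 - c * d + d\<^sup>2)"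
      by (simp add: power2_eq_square algebra_simps)
    finally show False using nz by (auto simp: eis_norm_form_eq_0_iff xy eis_defs)
  qed
qed (simp_all add: eis_defs algebra_simps)

end

definition eis_omega :: eis (\<open>\<omega>\<close>) where "\<omega> = Eis 0 1"

definition eis_cnj :: "eis \<Rightarrow> eis" where
  "eis_cnj z = Eis (eis_fst z - eis_snd z) (- eis_snd z)"

definition eis_norm :: "eis \<Rightarrow> int" where
  "eis_norm z = (eis_fst z)\<^sup>2 - eis_fst z * eis_snd z + (eis_snd z)\<^sup>2"

definition eis_trace :: "eis \<Rightarrow> int" where
  "eis_trace z = 2 * eis_fst z - eis_snd z"

definition cube_roots :: "eis set" where "cube_roots = {1, \<omega>, \<omega>\<^sup>2}"

lemma eis_sel_simps [simp]:
  "eis_fst 0 = 0" "eis_snd 0 = 0" "eis_fst 1 = 1" "eis_snd 1 = 0"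
  "eis_fst (x + y) = eis_fst x + eis_fst y" "eis_snd (x + y) = eis_snd x + eis_snd y"
  "eis_fst (x - y) = eis_fst x - eis_fst y" "eis_snd (x - y) = eis_snd x - eis_snd y"
  "eis_fst (- x) = - eis_fst x" "eis_snd (- x) = - eis_snd x"
  "eis_fst (x * y) = eis_fst x * eis_fst y - eis_snd x * eis_snd y"
  "eis_snd (x * y) = eis_fst x * eis_snd y + eis_snd x * eis_fst y - eis_snd x * eis_snd y"
  "eis_fst \<omega> = 0" "eis_snd \<omega> = 1"
  "eis_fst (eis_cnj x) = eis_fst x - eis_snd x" "eis_snd (eis_cnj x) = - eis_snd x"
  by (simp_all add: eis_defs eis_omega_def eis_cnj_def)

lemma eis_of_nat_sel [simp]: "eis_fst (of_nat n) = int n" "eis_snd (of_nat n) = 0"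
  by (induction n) auto

lemma eis_of_int_sel [simp]: "eis_fst (of_int n) = n" "eis_snd (of_int n) = 0"
  by (cases n; simp)+

lemma eis_numeral_sel [simp]: "eis_fst (numeral n) = numeral n" "eis_snd (numeral n) = 0"
  using eis_of_int_sel[of "numeral n"] by simp_all

lemma eis_eq_iff: "x = y \<longleftrightarrow> eis_fst x = eis_fst y \<and> eis_snd x = eis_snd y"
  by (auto intro: eis.expand)

lemma eis_cnj_simps [simp]:
  "eis_cnj 0 = 0" "eis_cnj 1 = 1" "eis_cnj (of_nat n) = of_nat n" "eis_cnj (of_int i) = of_int i"
  "eis_cnj (eis_cnj x) = x" "eis_cnj \<omega> = \<omega>\<^sup>2" "eis_cnj (- x) = - eis_cnj x"
  "eis_cnj (x + y) = eis_cnj x + eis_cnj y" "eis_cnj (x - y) = eis_cnj x - eis_cnj y"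
  "eis_cnj (x * y) = eis_cnj x * eis_cnj y"
  by (simp_all add: eis_eq_iff power2_eq_square algebra_simps)

lemma eis_cnj_power [simp]: "eis_cnj (x ^ n) = eis_cnj x ^ n"
  by (induction n) auto

lemma eis_cnj_sum: "eis_cnj (sum f A) = (\<Sum>a\<in>A. eis_cnj (f a))"
  by (induction A rule: infinite_finite_induct) auto

lemma eis_cnj_eq_0_iff [simp]: "eis_cnj x = 0 \<longleftrightarrow> x = 0"
  by (auto simp: eis_eq_iff)

lemma eis_mult_cnj: "x * eis_cnj x = of_int (eis_norm x)"
  by (simp add: eis_eq_iff eis_norm_def power2_eq_square algebra_simps)

lemma eis_add_cnj: "x + eis_cnj x = of_int (eis_trace x)"
  by (simp add: eis_eq_iff eis_trace_def)

lemma eis_norm_mult [simp]: "eis_norm (x * y) = eis_norm x * eis_norm y"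
  by (simp add: eis_norm_def power2_eq_square algebra_simps)

lemma eis_norm_power [simp]: "eis_norm (x ^ n) = eis_norm x ^ n"
  by (induction n) (simp_all, simp add: eis_norm_def)

lemma eis_norm_of_nat [simp]: "eis_norm (of_nat n) = (int n)\<^sup>2"
  by (simp add: eis_norm_def)

lemma eis_norm_cnj [simp]: "eis_norm (eis_cnj x) = eis_norm x"
  by (simp add: eis_norm_def power2_eq_square algebra_simps)

lemma eis_norm_times_4: "4 * eis_norm x = (2 * eis_fst x - eis_snd x)\<^sup>2 + 3 * (eis_snd x)\<^sup>2"
  by (simp add: eis_norm_def power2_eq_square algebra_simps)

lemma eis_norm_pos_iff [simp]: "eis_norm x > 0 \<longleftrightarrow> x \<noteq> 0"
proof -
  have "eis_norm x \<ge> 0"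
    using eis_norm_times_4[of x] zero_le_power2[of "2 * eis_fst x - eis_snd x"]
      zero_le_power2[of "eis_snd x"] by linarith
  moreover have "eis_norm x = 0 \<longleftrightarrow> x = 0"
    by (simp add: eis_norm_def eis_norm_form_eq_0_iff eis_eq_iff)
  ultimately show ?thesis by linarith
qed

lemma of_int_dvd_eis_iff: "of_int n dvd x \<longleftrightarrow> n dvd eis_fst x \<and> n dvd eis_snd x"
proof
  assume "of_int n dvd x"
  then show "n dvd eis_fst x \<and> n dvd eis_snd x" by (auto elim!: dvdE)
next
  assume "n dvd eis_fst x \<and> n dvd eis_snd x"
  then obtain k l where "eis_fst x = n * k" "eis_snd x = n * l" by (auto elim!: dvdE)
  then have "x = of_int n * Eis k l" by (simp add: eis_eq_iff)
  then show "of_int n dvd x" by simp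
qed

lemma of_nat_dvd_eis_iff: "of_nat n dvd x \<longleftrightarrow> int n dvd eis_fst x \<and> int n dvd eis_snd x"
  using of_int_dvd_eis_iff[of "int n"] by simp

lemma ideal_cong_eis_iff:
  "[x = y] (ideal {of_nat n}) \<longleftrightarrow>
     [eis_fst x = eis_fst y] (mod int n) \<and> [eis_snd x = eis_snd y] (mod int n)"
  by (simp add: ideal_cong_singleton_iff of_nat_dvd_eis_iff cong_iff_dvd_diff)

lemma ideal_cong_eis_numeral_iff:
  "[x = y] (ideal {numeral n}) \<longleftrightarrow>
     [eis_fst x = eis_fst y] (mod numeral n) \<and> [eis_snd x = eis_snd y] (mod numeral n)"
  using ideal_cong_eis_iff[where n = "numeral n"] by simp

lemma ideal_cong_of_int_eis_iff:
  "[of_int a = (of_int b :: eis)] (ideal {of_nat n}) \<longleftrightarrow> [a = b] (mod int n)"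
  by (simp add: ideal_cong_eis_iff)

lemma ideal_cong_eis_cnj:
  "[x = y] (ideal {of_nat n}) \<Longrightarrow> [eis_cnj x = eis_cnj y] (ideal {of_nat n})"
  by (simp add: ideal_cong_eis_iff cong_diff cong_minus_minus_iff)

lemma ideal_cong_eis_mult_cancel:
  assumes "[c * x = c * y] (ideal {of_nat n})" and "coprime (int n) (eis_norm c)"
  shows "[x = y] (ideal {of_nat n})"
proof -
  have "eis_cnj c * (c * t) = of_int (eis_norm c) * t" for t
    by (simp add: mult_ac flip: eis_mult_cnj)
  with ideal_cong_mult_left[OF assms(1), of "eis_cnj c"]
  have "[of_int (eis_norm c) * x = of_int (eis_norm c) * y] (ideal {of_nat n})" by simp
  then show ?thesis
    using assms(2) by (simp add: ideal_cong_eis_iff cong_mult_lcancel coprime_commute)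
qed

lemma eis_omega_cubed: "\<omega> ^ 3 = 1"
  by (simp add: eis_eq_iff power3_eq_cube)

lemma one_in_cube_roots [simp]: "1 \<in> cube_roots"
  by (simp add: cube_roots_def)

lemma cube_roots_mult: "u \<in> cube_roots \<Longrightarrow> v \<in> cube_roots \<Longrightarrow> u * v \<in> cube_roots"
  by (auto simp: cube_roots_def eis_eq_iff power2_eq_square)

lemma cube_roots_power: "u \<in> cube_roots \<Longrightarrow> u ^ n \<in> cube_roots"
  by (induction n) (simp_all add: cube_roots_mult)

lemma omega_power_in_cube_roots [simp]: "\<omega> ^ n \<in> cube_roots"
  by (rule cube_roots_power) (simp add: cube_roots_def)

lemma cube_roots_cubed: "u \<in> cube_roots \<Longrightarrow> u ^ 3 = 1"
  by (auto simp: cube_roots_def eis_eq_iff power2_eq_square power3_eq_cube)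

lemma cube_roots_power_mod_3:
  assumes "u \<in> cube_roots"
  shows "u ^ n = u ^ (n mod 3)"
proof -
  have "u ^ n = u ^ (3 * (n div 3) + n mod 3)" by simp
  also have "\<dots> = u ^ (n mod 3)"
    by (simp only: power_add power_mult cube_roots_cubed[OF assms]) simp
  finally show ?thesis .
qed

lemma cube_roots_power_cong: "u \<in> cube_roots \<Longrightarrow> [m = n] (mod 3) \<Longrightarrow> u ^ m = u ^ n"
  unfolding cong_def by (metis cube_roots_power_mod_3)

lemma cube_roots_cnj: "u \<in> cube_roots \<Longrightarrow> eis_cnj u = u\<^sup>2"
  by (auto simp: cube_roots_def eis_eq_iff power2_eq_square)

lemma cube_roots_mult_cnj: "u \<in> cube_roots \<Longrightarrow> u * eis_cnj u = 1"
  using cube_roots_cubed[of u]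
  by (simp add: cube_roots_cnj power2_eq_square power3_eq_cube mult.assoc)

lemma cube_roots_idempotent: "u \<in> cube_roots \<Longrightarrow> u * u = u \<Longrightarrow> u = 1"
  by (auto simp: cube_roots_def eis_eq_iff power2_eq_square)

lemma cube_roots_square_eq_1: "u \<in> cube_roots \<Longrightarrow> u\<^sup>2 = 1 \<Longrightarrow> u = 1"
  by (auto simp: cube_roots_def eis_eq_iff power2_eq_square)

lemma cube_roots_eqI:
  assumes "u \<in> cube_roots" "v \<in> cube_roots" "[u = v] (ideal {of_nat n})" "n > 1"
  shows "u = v"
proof -
  have "\<not> int n dvd 1" "\<not> int n dvd - 1" using assms(4) by auto
  then show ?thesis
    using assms(1-3)
    by (auto simp: cube_roots_def ideal_cong_singleton_iff of_nat_dvd_eis_iff power2_eq_square)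
qed

lemma coprime_prime_iff:
  assumes "prime p"
  shows "coprime n (int p) \<longleftrightarrow> \<not> int p dvd n"
  using assms prime_imp_coprime[of "int p" n] prime_gt_1_nat[OF assms]
  by (auto simp: coprime_commute dest: coprime_common_divisor)

lemma fermat_int:
  assumes "prime p"
  shows "[a ^ p = a] (mod int p)"
proof -
  define n where "n = nat (a mod int p)"
  have "int n = a mod int p" using assms by (simp add: n_def prime_gt_0_nat)
  then have a: "[a = int n] (mod int p)" by (simp add: cong_def)
  have "[n ^ p = n] (mod p)"
  proof (cases "p dvd n")
    case True
    then show ?thesis
      using assms by (simp add: cong_def mod_eq_0_iff_dvd prime_dvd_power_iff prime_gt_0_nat)
  next
    case False
    with assms have "[n * n ^ (p - 1) = n * 1] (mod p)"
      by (intro cong_mult fermat_theorem cong_refl)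
    moreover have "n * n ^ (p - 1) = n ^ p"
      using assms prime_gt_0_nat by (cases p) auto
    ultimately show ?thesis by simp
  qed
  then have "[int n ^ p = int n] (mod int p)" by (metis cong_int_iff of_nat_power)
  with a show ?thesis by (meson cong_pow cong_sym cong_trans)
qed

lemma eis_power_prime:
  assumes "prime p"
  shows "[x ^ p = of_int (eis_fst x) + of_int (eis_snd x) * \<omega> ^ p] (ideal {of_nat p})"
proof -
  have fermat: "[of_int c ^ p = (of_int c :: eis)] (ideal {of_nat p})" for c
    using fermat_int[OF assms] by (simp only: ideal_cong_of_int_eis_iff flip: of_int_power)
  have "x ^ p = (of_int (eis_fst x) + of_int (eis_snd x) * \<omega>) ^ p"
    by (rule arg_cong[where f = "\<lambda>t. t ^ p"]) (simp add: eis_eq_iff)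
  also have "[\<dots> = of_int (eis_fst x) ^ p + (of_int (eis_snd x) * \<omega>) ^ p] (ideal {of_nat p})"
    by (rule ideal_cong_add_power_prime) (simp_all add: assms)
  also have "[\<dots> = of_int (eis_fst x) + of_int (eis_snd x) * \<omega> ^ p] (ideal {of_nat p})"
    unfolding power_mult_distrib by (intro ideal_cong_add ideal_cong_mult_right fermat)
  finally show ?thesis .
qed

lemma eis_frobenius_split:
  fixes x :: eis
  assumes "prime p" and "p mod 3 = 1"
  shows "[x ^ p = x] (ideal {of_nat p})"
proof -
  have "\<omega> ^ p = \<omega>" using cube_roots_power_mod_3[of \<omega> p] assms(2) by (simp add: cube_roots_def)
  then have "of_int (eis_fst x) + of_int (eis_snd x) * \<omega> ^ p = x" by (simp add: eis_eq_iff)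
  then show ?thesis using eis_power_prime[OF assms(1), of x] by simp
qed

lemma eis_frobenius_inert:
  assumes "prime p" and "p mod 3 = 2"
  shows "[x ^ p = eis_cnj x] (ideal {of_nat p})"
proof -
  have "\<omega> ^ p = \<omega>\<^sup>2" using cube_roots_power_mod_3[of \<omega> p] assms(2) by (simp add: cube_roots_def)
  then have "of_int (eis_fst x) + of_int (eis_snd x) * \<omega> ^ p = eis_cnj x"
    by (simp add: eis_eq_iff power2_eq_square)
  then show ?thesis using eis_power_prime[OF assms(1), of x] by simp
qed

lemma prime_mod_3_cases:
  fixes p :: nat
  assumes "prime p" and "p \<noteq> 3"
  obtains (split) "p mod 3 = 1" | (inert) "p mod 3 = 2"
proof -
  have "\<not> 3 dvd p" using assms by (auto simp: prime_nat_iff)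
  then have "p mod 3 = 1 \<or> p mod 3 = 2" by presburger
  then show thesis using that by blast
qed

lemma eis_frobenius_square:
  fixes x :: eis
  assumes "prime p" and "p \<noteq> 3"
  shows "[x ^ p\<^sup>2 = x] (ideal {of_nat p})"
proof -
  have "[(x ^ p) ^ p = x] (ideal {of_nat p})"
    using assms
  proof (cases rule: prime_mod_3_cases)
    case split
    note frob = eis_frobenius_split[OF assms(1) split]
    show ?thesis by (rule ideal_cong_trans[OF frob frob])
  next
    case inert
    note frob = eis_frobenius_inert[OF assms(1) inert]
    have "[(x ^ p) ^ p = eis_cnj (x ^ p)] (ideal {of_nat p})" by (rule frob)
    also have "[\<dots> = eis_cnj (eis_cnj x)] (ideal {of_nat p})" by (intro ideal_cong_eis_cnj frob)
    finally show ?thesis by simp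
  qed
  then show ?thesis by (simp add: power2_eq_square power_mult)
qed

section \<open>The group ring of \<open>\<int>/q\<close>\<close>

definition residue_periodic :: "nat \<Rightarrow> (int \<Rightarrow> 'a) \<Rightarrow> bool" where
  "residue_periodic q f \<longleftrightarrow> (\<forall>a. f (a mod int q) = f a)"

lemma residue_periodic_mod: "residue_periodic q f \<Longrightarrow> f (a mod int q) = f a"
  by (simp add: residue_periodic_def)

lemma residue_periodic_comp: "residue_periodic q f \<Longrightarrow> residue_periodic q (\<lambda>a. h (f a))"
  by (simp add: residue_periodic_def)

lemma residue_periodic_cong: "residue_periodic q f \<Longrightarrow> [a = b] (mod int q) \<Longrightarrow> f a = f b"
  unfolding cong_def by (metis residue_periodic_mod)

lemma residue_periodic_comp2:
  "residue_periodic q f \<Longrightarrow> residue_periodic q g \<Longrightarrow> residue_periodic q (\<lambda>a. h (f a) (g a))"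
  by (simp add: residue_periodic_def)

lemma residue_periodic_diff_left: "residue_periodic q f \<Longrightarrow> residue_periodic q (\<lambda>a. f (c - a))"
  unfolding residue_periodic_def by (metis mod_diff_right_eq)

lemma residue_periodic_diff_right: "residue_periodic q f \<Longrightarrow> residue_periodic q (\<lambda>a. f (a - c))"
  unfolding residue_periodic_def by (metis mod_diff_left_eq)

lemma sum_residues_reindex:
  fixes f :: "int \<Rightarrow> 'a :: comm_monoid_add"
  assumes "residue_periodic q f" and "q > 0"
    and h: "\<And>a b. [h a = h b] (mod int q) \<Longrightarrow> [a = b] (mod int q)"
  shows "(\<Sum>a\<in>{0..<int q}. f (h a)) = (\<Sum>a\<in>{0..<int q}. f a)"
proof -
  have inj: "inj_on (\<lambda>a. h a mod int q) {0..<int q}"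
  proof (rule inj_onI)
    fix a b assume ab: "a \<in> {0..<int q}" "b \<in> {0..<int q}"
    assume "h a mod int q = h b mod int q"
    then have "[h a = h b] (mod int q)" by (simp only: cong_def)
    then have "[a = b] (mod int q)" by (rule h)
    then show "a = b" using ab by (simp add: cong_def)
  qed
  have "(\<lambda>a. h a mod int q) ` {0..<int q} = {0..<int q}"
    by (rule endo_inj_surj) (use \<open>q > 0\<close> inj in auto)
  with inj have "bij_betw (\<lambda>a. h a mod int q) {0..<int q} {0..<int q}"
    by (simp add: bij_betw_def)
  from sum.reindex_bij_betw[OF this, of f] show ?thesis
    by (simp add: residue_periodic_mod[OF assms(1)])
qed

lemma sum_residues_scale:
  fixes f :: "int \<Rightarrow> 'a :: comm_monoid_add"
  assumes "residue_periodic q f" and "q > 0" and "coprime c (int q)"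
  shows "(\<Sum>a\<in>{0..<int q}. f (c * a)) = (\<Sum>a\<in>{0..<int q}. f a)"
  using assms by (intro sum_residues_reindex) (simp_all add: cong_mult_lcancel)

definition convolution :: "nat \<Rightarrow> (int \<Rightarrow> 'a) \<Rightarrow> (int \<Rightarrow> 'a) \<Rightarrow> int \<Rightarrow> 'a :: comm_ring_1" where
  "convolution q f g c = (\<Sum>a\<in>{0..<int q}. f a * g (c - a))"

lemma sum_convolution:
  assumes "residue_periodic q g" and "q > 0"
  shows "(\<Sum>c\<in>{0..<int q}. convolution q f g c) =
    (\<Sum>a\<in>{0..<int q}. f a) * (\<Sum>b\<in>{0..<int q}. g b)"
proof -
  have "(\<Sum>c\<in>{0..<int q}. g (c - a)) = (\<Sum>b\<in>{0..<int q}. g b)" for a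
  proof (rule sum_residues_reindex[OF assms])
    show "[b = c] (mod int q)" if "[b - a = c - a] (mod int q)" for b c
      using cong_add[OF that cong_refl[of a]] by simp
  qed
  then show ?thesis
    unfolding convolution_def
    by (subst sum.swap) (simp add: sum_distrib_right flip: sum_distrib_left)
qed

lemma convolution_scale:
  assumes "residue_periodic q f" "residue_periodic q g" and "q > 0" and "coprime c (int q)"
    and f: "\<And>a. f (c * a) = f c * f a" and g: "\<And>a. g (c * a) = g c * g a"
  shows "convolution q f g c = f c * g c * convolution q f g 1"
proof -
  have "residue_periodic q (\<lambda>a. f a * g (c - a))"
    by (intro residue_periodic_comp2[where h = "(*)"] residue_periodic_diff_left assms)
  then have "convolution q f g c = (\<Sum>a\<in>{0..<int q}. f (c * a) * g (c - c * a))"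
    unfolding convolution_def using assms(3,4) by (rule sum_residues_scale [symmetric])
  also have "\<dots> = (\<Sum>a\<in>{0..<int q}. f c * g c * (f a * g (1 - a)))"
  proof (rule sum.cong[OF refl])
    fix a
    have "g (c - c * a) = g c * g (1 - a)"
      by (subst g [symmetric]) (simp add: right_diff_distrib)
    then show "f (c * a) * g (c - c * a) = f c * g c * (f a * g (1 - a))"
      unfolding f by (simp add: mult_ac)
  qed
  finally show ?thesis by (simp add: convolution_def sum_distrib_left)
qed

definition group_ideal :: "nat \<Rightarrow> nat \<Rightarrow> 'a :: comm_ring_1 poly set" where
  "group_ideal q n = {monom 1 q - 1, of_nat n}"

definition group_elem :: "nat \<Rightarrow> int \<Rightarrow> 'a :: comm_ring_1 poly" where
  "group_elem q a = monom 1 (nat (a mod int q))"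

definition group_sum :: "nat \<Rightarrow> (int \<Rightarrow> 'a) \<Rightarrow> 'a :: comm_ring_1 poly" where
  "group_sum q f = (\<Sum>a\<in>{0..<int q}. smult (f a) (group_elem q a))"

lemma of_nat_in_group_ideal: "of_nat n \<in> group_ideal q n"
  by (simp add: group_ideal_def)

lemma ideal_cong_smult: "[f = g] (ideal S) \<Longrightarrow> [smult c f = smult c g] (ideal S)"
  using ideal_cong_mult_left[of S f g "[:c:]"] by simp

lemma residue_periodic_group_elem: "residue_periodic q (group_elem q)"
  by (simp add: residue_periodic_def group_elem_def)

lemma ideal_cong_monom_mod: "[monom 1 k = monom 1 (k mod q)] (ideal (group_ideal q n))"
proof -
  have "[monom 1 q = 1] (ideal (group_ideal q n))"
    by (rule ideal_cong_dvdI[OF dvd_refl]) (simp add: group_ideal_def)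
  then have "[monom 1 q ^ (k div q) * monom 1 (k mod q) = 1 ^ (k div q) * monom 1 (k mod q)]
      (ideal (group_ideal q n))"
    by (intro ideal_cong_mult_right ideal_cong_power)
  also have "monom 1 q ^ (k div q) * monom 1 (k mod q) = monom 1 k"
    by (simp add: monom_power mult_monom)
  finally show ?thesis by simp
qed

lemma ideal_cong_group_elem_mult:
  assumes "q > 0"
  shows "[group_elem q a * group_elem q b = group_elem q (a + b)] (ideal (group_ideal q n))"
proof -
  have "nat ((a + b) mod int q) = (nat (a mod int q) + nat (b mod int q)) mod q"
    using assms by (simp add: nat_add_distrib [symmetric] nat_mod_as_int mod_add_eq)
  then show ?thesis
    by (simp add: group_elem_def mult_monom ideal_cong_monom_mod)
qed

lemma ideal_cong_group_elem_power:
  assumes "q > 0"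
  shows "[(group_elem q a :: 'a :: comm_ring_1 poly) ^ k = group_elem q (int k * a)]
    (ideal (group_ideal q n))"
proof (induction k)
  case 0
  show ?case by (simp add: group_elem_def monom_0 one_pCons)
next
  case (Suc k)
  have "[(group_elem q a :: 'a poly) ^ Suc k = group_elem q a * group_elem q (int k * a)]
      (ideal (group_ideal q n))"
    unfolding power_Suc by (intro ideal_cong_mult_left Suc)
  also have "[\<dots> = group_elem q (a + int k * a)] (ideal (group_ideal q n))"
    by (rule ideal_cong_group_elem_mult) fact
  finally show ?case by (simp add: algebra_simps)
qed

lemma group_sum_smult: "group_sum q (\<lambda>a. c * f a) = smult c (group_sum q f)"
  using sum_distrib_left[of "[:c:]" "\<lambda>a. smult (f a) (group_elem q a)" "{0..<int q}"]
  by (simp add: group_sum_def mult.commute)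

lemma ideal_cong_group_sum_mult:
  assumes "q > 0" and "residue_periodic q g"
  shows "[group_sum q f * group_sum q g = group_sum q (convolution q f g)]
    (ideal (group_ideal q n))"
proof -
  let ?A = "{0..<int q}"
  have "group_sum q f * group_sum q g =
      (\<Sum>a\<in>?A. \<Sum>b\<in>?A. smult (f a * g b) (group_elem q a * group_elem q b))"
    by (simp add: group_sum_def sum_product mult.commute)
  also have "[\<dots> = (\<Sum>a\<in>?A. \<Sum>b\<in>?A. smult (f a * g b) (group_elem q (a + b)))]
      (ideal (group_ideal q n))"
    by (intro ideal_cong_sum ideal_cong_smult ideal_cong_group_elem_mult assms)
  also have "(\<Sum>a\<in>?A. \<Sum>b\<in>?A. smult (f a * g b) (group_elem q (a + b))) =
      (\<Sum>a\<in>?A. \<Sum>c\<in>?A. smult (f a * g (c - a)) (group_elem q c))"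
  proof (rule sum.cong[OF refl])
    fix a
    define F where "F = (\<lambda>c. smult (f a * g (c - a)) (group_elem q c))"
    have "residue_periodic q F"
      unfolding F_def
      by (rule residue_periodic_comp2[where h = "\<lambda>x. smult (f a * x)"])
         (intro residue_periodic_diff_right residue_periodic_group_elem assms)+
    then have "(\<Sum>b\<in>?A. F (a + b)) = (\<Sum>c\<in>?A. F c)"
      using \<open>q > 0\<close> by (rule sum_residues_reindex) (simp add: cong_add_lcancel)
    then show "(\<Sum>b\<in>?A. smult (f a * g b) (group_elem q (a + b))) =
        (\<Sum>c\<in>?A. smult (f a * g (c - a)) (group_elem q c))" by (simp add: F_def)
  qed
  also have "\<dots> = group_sum q (convolution q f g)"
    unfolding group_sum_def convolution_def by (subst sum.swap) (simp add: smult_sum)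
  finally show ?thesis .
qed

lemma ideal_cong_group_sum_power_prime_power:
  assumes "prime p" and "coprime p q" and "q > 0" and "residue_periodic q g"
    and fg: "\<And>a. g (int (p ^ j) * a) = f a ^ (p ^ j)"
  shows "[group_sum q f ^ (p ^ j) = group_sum q g] (ideal (group_ideal q p))"
proof -
  let ?A = "{0..<int q}" and ?N = "int (p ^ j)"
  have "[group_sum q f ^ (p ^ j) = (\<Sum>a\<in>?A. smult (f a) (group_elem q a) ^ (p ^ j))]
      (ideal (group_ideal q p))"
    unfolding group_sum_def
    by (intro ideal_cong_sum_power_prime_power of_nat_in_group_ideal assms)
  also have "[\<dots> = (\<Sum>a\<in>?A. smult (g (?N * a)) (group_elem q (?N * a)))]
      (ideal (group_ideal q p))"
    unfolding smult_power fg
    by (intro ideal_cong_sum ideal_cong_smult ideal_cong_group_elem_power assms)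
  also have "\<dots> = group_sum q g"
    unfolding group_sum_def
  proof (rule sum_residues_scale[where f = "\<lambda>a. smult (g a) (group_elem q a)"])
    show "residue_periodic q (\<lambda>a. smult (g a) (group_elem q a))"
      by (intro residue_periodic_comp2[where h = smult] residue_periodic_group_elem assms)
  qed (use assms in simp_all)
  finally show ?thesis .
qed

definition residue_coeff :: "nat \<Rightarrow> nat \<Rightarrow> 'a :: comm_ring_1 poly \<Rightarrow> 'a" where
  "residue_coeff q r f = (\<Sum>i\<le>degree f. if i mod q = r then coeff f i else 0)"

lemma residue_coeff_eq_sum:
  assumes "degree f \<le> m"
  shows "residue_coeff q r f = (\<Sum>i\<le>m. if i mod q = r then coeff f i else 0)"
  unfolding residue_coeff_def
  by (rule sum.mono_neutral_left) (use assms in \<open>auto simp: coeff_eq_0\<close>)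

lemma residue_coeff_add: "residue_coeff q r (f + g) = residue_coeff q r f + residue_coeff q r g"
proof -
  define m where "m = max (degree f) (degree g)"
  have "degree f \<le> m" "degree g \<le> m" "degree (f + g) \<le> m"
    by (auto simp: m_def degree_add_le_max)
  then show ?thesis
    by (auto simp: residue_coeff_eq_sum[of _ m] sum.distrib [symmetric] intro!: sum.cong)
qed

lemma residue_coeff_smult: "residue_coeff q r (smult c f) = c * residue_coeff q r f"
  by (subst residue_coeff_eq_sum[of _ "degree f"])
     (auto simp: residue_coeff_def sum_distrib_left degree_smult_le intro!: sum.cong)

lemma residue_coeff_diff: "residue_coeff q r (f - g) = residue_coeff q r f - residue_coeff q r g"
  using residue_coeff_add[of q r "f - g" g] by simp

lemma residue_coeff_0 [simp]: "residue_coeff q r 0 = 0"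
  by (auto simp: residue_coeff_def intro!: sum.neutral)

lemma residue_coeff_sum: "residue_coeff q r (sum f A) = (\<Sum>a\<in>A. residue_coeff q r (f a))"
  by (induction A rule: infinite_finite_induct) (simp_all add: residue_coeff_add)

lemma residue_coeff_monom: "residue_coeff q r (monom c i) = (if i mod q = r then c else 0)"
proof -
  have "residue_coeff q r (monom c i) = (\<Sum>j\<le>i. if j mod q = r then coeff (monom c i) j else 0)"
    by (rule residue_coeff_eq_sum) (simp add: degree_monom_le)
  also have "\<dots> = (\<Sum>j\<le>i. if j = i then (if i mod q = r then c else 0) else 0)"
    by (intro sum.cong) auto
  finally show ?thesis by simp
qed

lemma residue_coeff_monom_mult: "residue_coeff q r (monom 1 q * f) = residue_coeff q r f"
proof -
  have *: "monom 1 q * f = (\<Sum>i\<le>degree f. monom (coeff f i) (q + i))"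
    by (subst poly_as_sum_of_monoms [symmetric]) (simp add: sum_distrib_left mult_monom)
  show ?thesis
    unfolding * by (simp add: residue_coeff_sum residue_coeff_monom) (simp add: residue_coeff_def)
qed

lemma ideal_cong_residue_coeff:
  assumes "[f = g] (ideal (group_ideal q n))"
  shows "[residue_coeff q r f = residue_coeff q r g] (ideal {of_nat n})"
proof -
  obtain u v where "f - g = (monom 1 q - 1) * u + of_nat n * v"
    using assms by (auto simp: group_ideal_def ideal_cong_pair_iff)
  then have "f - g = monom 1 q * u - u + smult (of_nat n) v"
    by (simp add: algebra_simps of_nat_poly)
  then have "residue_coeff q r f - residue_coeff q r g = of_nat n * residue_coeff q r v"
    by (simp only: residue_coeff_diff [symmetric])
       (simp add: residue_coeff_add residue_coeff_diff residue_coeff_monom_mult residue_coeff_smult)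
  then show ?thesis by (simp add: ideal_cong_singleton_iff)
qed

lemma residue_coeff_group_sum:
  assumes "r < q"
  shows "residue_coeff q r (group_sum q f) = f (int r)"
proof -
  have "residue_coeff q r (group_sum q f) =
      (\<Sum>a\<in>{0..<int q}. if a = int r then f (int r) else 0)"
    unfolding group_sum_def residue_coeff_sum residue_coeff_smult
  proof (intro sum.cong refl)
    fix a assume "a \<in> {0..<int q}"
    moreover from this have "nat a mod q = nat a" by (simp add: nat_less_iff)
    ultimately show "f a * residue_coeff q r (group_elem q a) =
        (if a = int r then f (int r) else 0)"
      by (auto simp: group_elem_def residue_coeff_monom)
  qed
  then show ?thesis using assms by simp
qed

section \<open>Cubic characters and Jacobi sums\<close>

locale cubic_character =
  fixes q :: nat and chi :: "int \<Rightarrow> eis"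
  assumes prime_q: "prime q"
    and chi_periodic: "residue_periodic q chi"
    and chi_mult: "chi (m * n) = chi m * chi n"
    and chi_eq_0: "int q dvd n \<Longrightarrow> chi n = 0"
    and chi_in_cube_roots: "coprime n (int q) \<Longrightarrow> chi n \<in> cube_roots"
    and nontrivial: "\<exists>n. coprime n (int q) \<and> chi n \<noteq> 1"

lemma exists_primroot_power_cong:
  assumes "prime q" and "residue_primroot q g" and "coprime n (int q)"
  shows "\<exists>i. [n = int g ^ i] (mod int q)"
proof -
  have "q > 1" using assms(1) by (rule prime_gt_1_nat)
  define m where "m = nat (n mod int q)"
  have m: "int m = n mod int q" using \<open>q > 1\<close> by (simp add: m_def)
  then have "coprime m q"
    using assms(3) \<open>q > 1\<close> by (simp flip: coprime_int_iff)
  moreover have "m < q" using \<open>q > 1\<close> by (simp add: m_def nat_less_iff)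
  ultimately have "m \<in> totatives q"
    using \<open>q > 1\<close> by (auto simp: totatives_def intro!: Nat.gr0I)
  then obtain i where "m = g ^ i mod q"
    using residue_primroot_is_generator[OF \<open>q > 1\<close> assms(2)] by (auto simp: bij_betw_def)
  then have "n mod int q = int g ^ i mod int q" using m by (simp add: zmod_int)
  then show ?thesis by (auto simp: cong_def)
qed

lemma primroot_power_cong_iff:
  assumes "prime q" and "residue_primroot q g"
  shows "[int g ^ i = int g ^ j] (mod int q) \<longleftrightarrow> [i = j] (mod (q - 1))"
proof -
  have "coprime q g" "ord q g = q - 1"
    using assms by (simp_all add: residue_primroot_def totient_prime)
  then show ?thesis
    using order_divides_expdiff[of q g i j] by (simp flip: of_nat_power add: cong_int_iff)
qed

lemma not_dvd_if_cong_primroot_power: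
  assumes "q > 1" and "residue_primroot q g" and "[n = int g ^ i] (mod int q)"
  shows "\<not> int q dvd n"
proof
  assume "int q dvd n"
  then have "int q dvd int g ^ i" using cong_dvd_iff[OF assms(3)] by simp
  moreover have "coprime (int g ^ i) (int q)"
    using assms(2) by (simp add: residue_primroot_def coprime_commute)
  ultimately have "is_unit (int q)" by (metis coprime_common_divisor dvd_refl)
  then show False using \<open>q > 1\<close> by simp
qed

definition primroot_cubic_character :: "nat \<Rightarrow> nat \<Rightarrow> int \<Rightarrow> eis" where
  "primroot_cubic_character q g n =
     (if int q dvd n then 0 else \<omega> ^ (SOME i. [n = int g ^ i] (mod int q)))"

lemma primroot_cubic_character_eq:
  assumes "prime q" and "q mod 3 = 1" and "residue_primroot q g" and "[n = int g ^ i] (mod int q)"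
  shows "primroot_cubic_character q g n = \<omega> ^ i"
proof -
  define j where "j = (SOME i. [n = int g ^ i] (mod int q))"
  have "[n = int g ^ j] (mod int q)" unfolding j_def using assms(4) by (rule someI)
  then have "[int g ^ j = int g ^ i] (mod int q)" using assms(4) by (meson cong_sym cong_trans)
  then have "[j = i] (mod (q - 1))" using primroot_power_cong_iff[OF assms(1,3)] by simp
  moreover have "3 dvd q - 1" using assms(2) by presburger
  ultimately have "[j = i] (mod 3)" by (rule cong_dvd_modulus_nat)
  then have "\<omega> ^ j = \<omega> ^ i" by (intro cube_roots_power_cong) (simp add: cube_roots_def)
  then show ?thesis
    using not_dvd_if_cong_primroot_power[OF prime_gt_1_nat[OF assms(1)] assms(3,4)]
    by (simp add: primroot_cubic_character_def j_def)
qed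

lemma cubic_character_primroot_cubic_character:
  assumes "prime q" and "q mod 3 = 1" and "residue_primroot q g"
  shows "cubic_character q (primroot_cubic_character q g)"
proof (rule cubic_character.intro)
  note chi_eq = primroot_cubic_character_eq[OF assms]
  have log: "\<exists>i. [n = int g ^ i] (mod int q)" if "\<not> int q dvd n" for n
    using that by (intro exists_primroot_power_cong assms) (simp add: coprime_prime_iff assms(1))
  fix m n :: int
  show "primroot_cubic_character q g (m * n) =
      primroot_cubic_character q g m * primroot_cubic_character q g n"
  proof (cases "int q dvd m * n")
    case True
    then have "int q dvd m \<or> int q dvd n" using assms(1) by (simp add: prime_dvd_mult_iff)
    then show ?thesis by (auto simp: primroot_cubic_character_def)
  next
    case False
    then obtain i j where ij: "[m = int g ^ i] (mod int q)" "[n = int g ^ j] (mod int q)"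
      using log by (meson dvd_mult dvd_mult2)
    then have "[m * n = int g ^ (i + j)] (mod int q)" unfolding power_add by (rule cong_mult)
    from chi_eq[OF this] show ?thesis by (simp only: chi_eq[OF ij(1)] chi_eq[OF ij(2)] power_add)
  qed
  show "primroot_cubic_character q g n \<in> cube_roots" if "coprime n (int q)"
    using that by (simp add: primroot_cubic_character_def coprime_prime_iff assms(1))
next
  have "primroot_cubic_character q g (int g) = \<omega> ^ 1"
    by (rule primroot_cubic_character_eq[OF assms]) simp
  then have "primroot_cubic_character q g (int g) \<noteq> 1" by (simp add: eis_eq_iff)
  moreover have "coprime (int g) (int q)"
    using assms(3) by (simp add: residue_primroot_def coprime_commute)
  ultimately show "\<exists>n. coprime n (int q) \<and> primroot_cubic_character q g n \<noteq> 1" by blast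
next
  show "residue_periodic q (primroot_cubic_character q g)"
    by (simp add: residue_periodic_def primroot_cubic_character_def cong_def dvd_mod_iff)
qed (simp_all add: primroot_cubic_character_def assms(1))

lemma cubic_character_exists:
  assumes "prime q" and "q mod 3 = 1"
  shows "\<exists>chi. cubic_character q chi"
  using prime_primitive_root_exists[of q] prime_gt_1_nat[OF assms(1)] assms
    cubic_character_primroot_cubic_character by blast

context cubic_character
begin

lemma q_gt_1: "q > 1" and q_pos: "q > 0"
  using prime_gt_1_nat[OF prime_q] by simp_all

lemmas coprime_q_iff = coprime_prime_iff[OF prime_q]

lemma chi_cong: "[m = n] (mod int q) \<Longrightarrow> chi m = chi n"
  using chi_periodic by (rule residue_periodic_cong)

lemma chi_1: "chi 1 = 1"
  by (rule cube_roots_idempotent) (simp_all add: chi_in_cube_roots flip: chi_mult)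

lemma chi_minus: "chi (- n) = chi n"
proof -
  have "(chi (- 1))\<^sup>2 = 1" by (simp add: power2_eq_square chi_1 flip: chi_mult)
  moreover have "chi (- 1) \<in> cube_roots" by (rule chi_in_cube_roots) simp
  ultimately have "chi (- 1) = 1" by (simp add: cube_roots_square_eq_1)
  then show ?thesis using chi_mult[of "- 1" n] by simp
qed

lemma chi_square: "(chi n)\<^sup>2 = eis_cnj (chi n)"
  by (cases "int q dvd n") (simp_all add: chi_eq_0 cube_roots_cnj chi_in_cube_roots coprime_q_iff)

lemma chi_mult_cnj: "chi n * eis_cnj (chi n) = (if int q dvd n then 0 else 1)"
  by (simp add: chi_eq_0 cube_roots_mult_cnj chi_in_cube_roots coprime_q_iff)

lemma q_neq_3: "q \<noteq> 3"
proof
  assume "q = 3"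
  obtain n where n: "coprime n (int q)" "chi n \<noteq> 1" using nontrivial by blast
  then have "\<not> 3 dvd n" using \<open>q = 3\<close> unfolding coprime_q_iff by simp
  then have "[n = 1] (mod int q) \<or> [n = - 1] (mod int q)"
    unfolding \<open>q = 3\<close> cong_iff_dvd_diff by simp presburger
  then have "chi n = 1" using chi_cong chi_minus[of 1] chi_1 by metis
  with n show False by simp
qed

lemma sum_chi: "(\<Sum>a\<in>{0..<int q}. chi a) = 0"
proof -
  obtain n where n: "coprime n (int q)" "chi n \<noteq> 1" using nontrivial by blast
  have "chi n * (\<Sum>a\<in>{0..<int q}. chi a) = (\<Sum>a\<in>{0..<int q}. chi (n * a))"
    by (simp add: chi_mult sum_distrib_left)
  also have "\<dots> = (\<Sum>a\<in>{0..<int q}. chi a)"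
    using chi_periodic q_pos n(1) by (rule sum_residues_scale)
  finally have "(chi n - 1) * (\<Sum>a\<in>{0..<int q}. chi a) = 0" by (simp add: algebra_simps)
  with n(2) show ?thesis by simp
qed

definition jacobi_sum :: eis where
  "jacobi_sum = convolution q chi chi 1"

abbreviation chi_cnj :: "int \<Rightarrow> eis" where "chi_cnj \<equiv> \<lambda>a. eis_cnj (chi a)"

lemma chi_cnj_periodic: "residue_periodic q chi_cnj"
  using chi_periodic by (rule residue_periodic_comp)

lemma chi_diff_if_dvd: "int q dvd c \<Longrightarrow> chi (c - a) = chi a"
  using chi_cong[of "c - a" "- a"] by (simp add: cong_iff_dvd_diff chi_minus)

lemma convolution_chi: "convolution q chi chi c = jacobi_sum * eis_cnj (chi c)"
proof (cases "int q dvd c")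
  case True
  then have "convolution q chi chi c = eis_cnj (\<Sum>a\<in>{0..<int q}. chi a)"
    by (simp add: convolution_def chi_diff_if_dvd chi_square eis_cnj_sum flip: power2_eq_square)
  then show ?thesis using True by (simp add: sum_chi chi_eq_0)
next
  case False
  then have "convolution q chi chi c = chi c * chi c * convolution q chi chi 1"
    by (intro convolution_scale chi_periodic q_pos chi_mult) (simp add: coprime_q_iff)
  then show ?thesis
    by (simp add: jacobi_sum_def mult.commute chi_square flip: power2_eq_square)
qed

lemma convolution_chi_cnj_if_dvd:
  assumes "int q dvd c"
  shows "convolution q chi chi_cnj c = of_nat q - 1"
proof -
  have "convolution q chi chi_cnj c = (\<Sum>a\<in>{0..<int q}. if int q dvd a then 0 else 1)"
    using assms by (simp add: convolution_def chi_diff_if_dvd chi_mult_cnj)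
  also have "\<dots> = (\<Sum>a\<in>{0..<int q} - {0}. 1)"
    by (rule sum.mono_neutral_cong_right) (auto dest: zdvd_imp_le)
  finally show ?thesis using q_pos by (simp add: card_Diff_singleton of_nat_diff)
qed

lemma convolution_chi_cnj:
  "convolution q chi chi_cnj c = (if int q dvd c then of_nat q else 0) - 1"
proof -
  let ?C = "convolution q chi chi_cnj" and ?A = "{0..<int q}"
  have scale: "?C c = ?C 1" if "\<not> int q dvd c" for c
  proof -
    have "?C c = chi c * chi_cnj c * ?C 1"
      using that
      by (intro convolution_scale chi_periodic chi_cnj_periodic q_pos)
         (simp_all add: coprime_q_iff chi_mult)
    then show ?thesis using that by (simp add: chi_mult_cnj)
  qed
  have "(of_nat q - 1) * (?C 1 + 1) = ?C 0 + (\<Sum>c\<in>?A - {0}. ?C 1)"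
    using q_pos
    by (simp add: convolution_chi_cnj_if_dvd card_Diff_singleton of_nat_diff algebra_simps)
  also have "(\<Sum>c\<in>?A - {0}. ?C 1) = (\<Sum>c\<in>?A - {0}. ?C c)"
    by (intro sum.cong refl scale [symmetric]) (auto dest: zdvd_imp_le)
  also have "?C 0 + (\<Sum>c\<in>?A - {0}. ?C c) = (\<Sum>c\<in>?A. ?C c)"
    using q_pos by (subst sum.remove[of ?A 0]) auto
  also have "\<dots> = 0"
    by (simp add: sum_convolution[OF chi_cnj_periodic q_pos] sum_chi)
  finally have "?C 1 + 1 = 0" using q_gt_1 by (simp add: eis_eq_iff)
  then have "?C 1 = - 1" by (simp add: add_eq_0_iff2)
  then show ?thesis using scale[of c] by (simp add: convolution_chi_cnj_if_dvd)
qed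

abbreviation gauss :: "eis poly" where "gauss \<equiv> group_sum q chi"
abbreviation gauss_cnj :: "eis poly" where "gauss_cnj \<equiv> group_sum q chi_cnj"

abbreviation gauss_norm :: "eis poly" where
  "gauss_norm \<equiv> group_sum q (\<lambda>c. (if int q dvd c then of_nat q else 0) - 1)"

lemma gauss_square: "[gauss * gauss = smult jacobi_sum gauss_cnj] (ideal (group_ideal q n))"
proof -
  have "convolution q chi chi = (\<lambda>c. jacobi_sum * chi_cnj c)" by (rule ext) (rule convolution_chi)
  then show ?thesis
    using ideal_cong_group_sum_mult[OF q_pos chi_periodic, where f = chi]
    by (simp add: group_sum_smult)
qed

lemma gauss_cnj_square:
  "[gauss_cnj * gauss_cnj = smult (eis_cnj jacobi_sum) gauss] (ideal (group_ideal q n))"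
proof -
  have "convolution q chi_cnj chi_cnj c = eis_cnj (convolution q chi chi c)" for c
    by (simp add: convolution_def eis_cnj_sum)
  then have "convolution q chi_cnj chi_cnj = (\<lambda>c. eis_cnj jacobi_sum * chi c)"
    by (simp add: convolution_chi fun_eq_iff)
  then show ?thesis
    using ideal_cong_group_sum_mult[OF q_pos chi_cnj_periodic, where f = chi_cnj]
    by (simp add: group_sum_smult)
qed

lemma gauss_mult_cnj: "[gauss * gauss_cnj = gauss_norm] (ideal (group_ideal q n))"
  using ideal_cong_group_sum_mult[OF q_pos chi_cnj_periodic, where f = chi]
  by (simp add: convolution_chi_cnj[abs_def])

lemma gauss_mult_norm: "[gauss * gauss_norm = smult (of_nat q) gauss] (ideal (group_ideal q n))"
proof -
  let ?A = "{0..<int q}"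
  define d :: "int \<Rightarrow> eis" where "d = (\<lambda>c. (if int q dvd c then of_nat q else 0) - 1)"
  have "convolution q chi d c = of_nat q * chi c" for c
  proof -
    have "int q dvd c - a \<longleftrightarrow> a = c mod int q" if "a \<in> ?A" for a
      using that q_pos by (auto simp: mod_eq_dvd_iff [symmetric])
    moreover have "chi (c mod int q) = chi c" by (intro chi_cong) simp
    ultimately have "convolution q chi d c =
        (\<Sum>a\<in>?A. (if a = c mod int q then of_nat q * chi c else 0) - chi a)"
      unfolding convolution_def d_def by (intro sum.cong) (auto simp: algebra_simps)
    then show ?thesis using q_pos by (simp add: sum_subtractf sum_chi)
  qed
  then have "convolution q chi d = (\<lambda>c. of_nat q * chi c)" by (rule ext)
  moreover have "residue_periodic q d" by (simp add: residue_periodic_def d_def dvd_mod_iff)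
  from ideal_cong_group_sum_mult[OF q_pos this, where f = chi]
  have "[gauss * group_sum q d = group_sum q (convolution q chi d)] (ideal (group_ideal q n))" .
  ultimately show ?thesis by (simp add: group_sum_smult d_def)
qed

lemma gauss_power:
  "[gauss ^ (3 * m + 1) = smult ((jacobi_sum * of_nat q) ^ m) gauss] (ideal (group_ideal q n))"
proof (induction m)
  case (Suc m)
  let ?I = "group_ideal q n" and ?c = "(jacobi_sum * of_nat q) ^ m"
  have expand: "3 * Suc m + 1 = Suc (Suc (Suc (3 * m + 1)))" by simp
  have "gauss ^ (3 * Suc m + 1) = (gauss * gauss * gauss) * gauss ^ (3 * m + 1)"
    unfolding expand by (simp only: power_Suc mult.assoc)
  also have "[\<dots> = (smult jacobi_sum gauss_cnj * gauss) * smult ?c gauss] (ideal ?I)"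
    by (intro ideal_cong_mult ideal_cong_refl gauss_square Suc)
  also have "\<dots> = smult (?c * jacobi_sum) (gauss * (gauss * gauss_cnj))"
    by (simp add: mult_ac)
  also have "[\<dots> = smult (?c * jacobi_sum) (gauss * gauss_norm)] (ideal ?I)"
    by (intro ideal_cong_smult ideal_cong_mult_left gauss_mult_cnj)
  also have "[\<dots> = smult (?c * jacobi_sum) (smult (of_nat q) gauss)] (ideal ?I)"
    by (intro ideal_cong_smult gauss_mult_norm)
  finally show ?case by (simp add: mult_ac)
qed simp

lemma residue_coeff_gauss: "residue_coeff q 1 gauss = 1"
  using q_gt_1 by (simp add: residue_coeff_group_sum chi_1)

lemma residue_coeff_gauss_norm: "residue_coeff q 1 gauss_norm = - 1"
  using q_gt_1 by (simp add: residue_coeff_group_sum)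

text \<open>With \<open>N\<close> the product of the Gauss sum and its conjugate, \<open>N\<^sup>2\<close> is both \<open>q N\<close> and the product of \<open>N\<close>
  with the Jacobi sum and its conjugate.\<close>

lemma jacobi_sum_mult_cnj: "jacobi_sum * eis_cnj jacobi_sum = of_nat q"
proof -
  let ?I = "group_ideal q 0 :: eis poly set"
  have "[gauss * gauss_cnj * (gauss * gauss_cnj) =
      smult (jacobi_sum * eis_cnj jacobi_sum) gauss_norm] (ideal ?I)"
  proof -
    have "gauss * gauss_cnj * (gauss * gauss_cnj) = (gauss * gauss) * (gauss_cnj * gauss_cnj)"
      by (simp add: mult_ac)
    also have "[\<dots> = smult jacobi_sum gauss_cnj * smult (eis_cnj jacobi_sum) gauss] (ideal ?I)"
      by (intro ideal_cong_mult gauss_square gauss_cnj_square)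
    also have "\<dots> = smult (jacobi_sum * eis_cnj jacobi_sum) (gauss * gauss_cnj)"
      by (simp add: mult_ac)
    also have "[\<dots> = smult (jacobi_sum * eis_cnj jacobi_sum) gauss_norm] (ideal ?I)"
      by (intro ideal_cong_smult gauss_mult_cnj)
    finally show ?thesis .
  qed
  moreover have "[gauss * gauss_cnj * (gauss * gauss_cnj) = smult (of_nat q) gauss_norm] (ideal ?I)"
  proof -
    have "[gauss * gauss_cnj * (gauss * gauss_cnj) = gauss * gauss_cnj * gauss_norm] (ideal ?I)"
      by (intro ideal_cong_mult_left gauss_mult_cnj)
    also have "gauss * gauss_cnj * gauss_norm = gauss_cnj * (gauss * gauss_norm)"
      by (simp add: mult_ac)
    also have "[\<dots> = gauss_cnj * smult (of_nat q) gauss] (ideal ?I)"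
      by (intro ideal_cong_mult_left gauss_mult_norm)
    also have "\<dots> = smult (of_nat q) (gauss * gauss_cnj)" by (simp add: mult_ac)
    also have "[\<dots> = smult (of_nat q) gauss_norm] (ideal ?I)"
      by (intro ideal_cong_smult gauss_mult_cnj)
    finally show ?thesis .
  qed
  ultimately have "[smult (jacobi_sum * eis_cnj jacobi_sum) gauss_norm =
      smult (of_nat q) gauss_norm] (ideal ?I)"
    by (meson ideal_cong_sym ideal_cong_trans)
  from ideal_cong_residue_coeff[OF this, of 1] show ?thesis
    unfolding residue_coeff_smult residue_coeff_gauss_norm by (simp add: ideal_cong_singleton_iff)
qed

lemma eis_norm_jacobi_sum: "eis_norm jacobi_sum = int q"
  using jacobi_sum_mult_cnj by (simp add: eis_mult_cnj eis_eq_iff)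

lemma coprime_prime_q: "prime p \<Longrightarrow> p \<noteq> q \<Longrightarrow> coprime p q"
  using prime_q by (simp add: primes_coprime)

text \<open>The cube of the Gauss sum is \<open>J (q - \<Sum>X\<^sup>a)\<close> on one side and by Frobenius \<open>\<Sum>\<chi>(a)\<^sup>3 X\<^sup>3\<^sup>a\<close> on
  the other, which fixes \<open>J\<close> modulo 3.\<close>

lemma jacobi_sum_mod_3: "[jacobi_sum = - 1] (ideal {of_nat 3})"
proof -
  define g :: "int \<Rightarrow> eis" where "g = (\<lambda>a. if int q dvd a then 0 else 1)"
  have coprime: "coprime 3 q" using q_neq_3 by (intro coprime_prime_q) auto
  have "[gauss ^ (3 ^ 1) = group_sum q g] (ideal (group_ideal q 3))"
  proof (rule ideal_cong_group_sum_power_prime_power)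
    show "residue_periodic q g" by (simp add: residue_periodic_def g_def dvd_mod_iff)
    fix a
    have "coprime (int q) 3" using coprime by (simp add: coprime_commute flip: coprime_int_iff)
    then have "int q dvd 3 * a \<longleftrightarrow> int q dvd a" by (simp add: coprime_dvd_mult_right_iff)
    then show "g (int (3 ^ 1) * a) = chi a ^ (3 ^ 1)"
      by (simp add: g_def chi_eq_0 cube_roots_cubed chi_in_cube_roots coprime_q_iff)
  qed (use coprime q_pos in auto)
  moreover have "[gauss ^ (3 ^ 1) = smult jacobi_sum gauss_norm] (ideal (group_ideal q 3))"
  proof -
    have "gauss ^ (3 ^ 1) = (gauss * gauss) * gauss" by (simp add: power3_eq_cube)
    also have "[\<dots> = smult jacobi_sum gauss_cnj * gauss] (ideal (group_ideal q 3))"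
      by (intro ideal_cong_mult_right gauss_square)
    also have "\<dots> = smult jacobi_sum (gauss * gauss_cnj)" by (simp add: mult.commute)
    also have "[\<dots> = smult jacobi_sum gauss_norm] (ideal (group_ideal q 3))"
      by (intro ideal_cong_smult gauss_mult_cnj)
    finally show ?thesis .
  qed
  ultimately have "[group_sum q g = smult jacobi_sum gauss_norm] (ideal (group_ideal q 3))"
    by (meson ideal_cong_sym ideal_cong_trans)
  from ideal_cong_residue_coeff[OF this, of 1]
  have "[1 = - jacobi_sum] (ideal {of_nat 3})"
    using q_gt_1 unfolding residue_coeff_smult residue_coeff_gauss_norm
    by (simp add: residue_coeff_group_sum g_def)
  from ideal_cong_mult_left[OF this, of "- 1"] show ?thesis by (simp add: ideal_cong_sym)
qed

end

section \<open>Cubic reciprocity for rational primes\<close>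

definition euler_exponent :: "int \<Rightarrow> nat" where
  "euler_exponent n = nat ((n\<^sup>2 - 1) div 3)"

lemma three_times_euler_exponent:
  assumes "\<not> 3 dvd n"
  shows "3 * int (euler_exponent n) = n\<^sup>2 - 1"
proof -
  have "n mod 3 = 1 \<or> n mod 3 = 2" using assms by presburger
  then have "(n mod 3)\<^sup>2 mod 3 = 1" by (elim disjE) (simp_all del: power_mod)
  then have "n\<^sup>2 mod 3 = 1" by (simp only: power_mod)
  then have "3 * ((n\<^sup>2 - 1) div 3) = n\<^sup>2 - 1" by presburger
  moreover have "n \<noteq> 0" using assms by auto
  then have "n\<^sup>2 - 1 \<ge> 0" by (simp add: int_one_le_iff_zero_less)
  ultimately show ?thesis by (simp add: euler_exponent_def pos_imp_zdiv_nonneg_iff)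
qed

lemma prime_square_eq_euler_exponent:
  fixes p :: nat
  assumes "prime p" and "p \<noteq> 3"
  shows "p\<^sup>2 = 3 * euler_exponent (int p) + 1"
proof -
  have "\<not> 3 dvd p" using assms by (auto simp: prime_nat_iff)
  then have "\<not> 3 dvd int p" by presburger
  then have "int (p\<^sup>2) = int (3 * euler_exponent (int p) + 1)"
    using three_times_euler_exponent by simp
  then show ?thesis by (simp only: of_nat_eq_iff)
qed

text \<open>
  Euler's criterion for \<open>(z/p)\<^sub>3 = u\<close>. The exponent \<open>(p\<^sup>2 - 1)/3\<close> instead of the usual \<open>(p - 1)/3\<close> or
  \<open>(p + 1)/3\<close> gives a single congruence for split and inert primes.
\<close>

definition euler_cubic :: "nat \<Rightarrow> eis \<Rightarrow> eis \<Rightarrow> bool" where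
  "euler_cubic p z u \<longleftrightarrow>
     [eis_cnj z ^ euler_exponent (int p) = u * z ^ euler_exponent (int p)] (ideal {of_nat p})"

lemma euler_cubic_mult:
  assumes "euler_cubic p x u" and "euler_cubic p y v"
  shows "euler_cubic p (x * y) (u * v)"
  using ideal_cong_mult[OF assms[unfolded euler_cubic_def]]
  by (simp add: euler_cubic_def power_mult_distrib mult_ac)

lemma euler_cubic_of_int: "euler_cubic p (of_int n) 1"
  by (simp add: euler_cubic_def)

lemma euler_cubic_cnj: "euler_cubic p z u \<Longrightarrow> euler_cubic p (eis_cnj z) (eis_cnj u)"
  unfolding euler_cubic_def by (drule ideal_cong_eis_cnj) simp

lemma euler_cubic_cong:
  assumes "euler_cubic p y u" and "[z = y] (ideal {of_nat p})"
  shows "euler_cubic p z u"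
proof -
  let ?E = "euler_exponent (int p)" and ?P = "{of_nat p} :: eis set"
  have "[eis_cnj z ^ ?E = eis_cnj y ^ ?E] (ideal ?P)"
    by (intro ideal_cong_power ideal_cong_eis_cnj assms)
  also have "[\<dots> = u * y ^ ?E] (ideal ?P)" using assms(1) by (simp only: euler_cubic_def)
  also have "[\<dots> = u * z ^ ?E] (ideal ?P)"
    by (intro ideal_cong_mult_left ideal_cong_power ideal_cong_sym[OF assms(2)])
  finally show ?thesis by (simp only: euler_cubic_def)
qed

lemma euler_cubic_unique:
  assumes "euler_cubic p z u" "euler_cubic p z v" and "u \<in> cube_roots" "v \<in> cube_roots"
    and "coprime (int p) (eis_norm z)" and "prime p"
  shows "u = v"
proof -
  let ?E = "euler_exponent (int p)"
  have "[u * z ^ ?E = v * z ^ ?E] (ideal {of_nat p})"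
    using assms(1,2) unfolding euler_cubic_def by (meson ideal_cong_sym ideal_cong_trans)
  then have "[z ^ ?E * u = z ^ ?E * v] (ideal {of_nat p})" by (simp only: mult.commute)
  then have "[u = v] (ideal {of_nat p})"
    by (rule ideal_cong_eis_mult_cancel) (simp add: assms(5))
  with assms(3,4,6) show ?thesis by (intro cube_roots_eqI prime_gt_1_nat)
qed

lemma eis_power_euler_exponent:
  assumes "prime p" "p \<noteq> 3" and "coprime (int p) (eis_norm x)"
  shows "[x ^ (3 * euler_exponent (int p)) = 1] (ideal {of_nat p})"
proof -
  have "[x * x ^ (3 * euler_exponent (int p)) = x * 1] (ideal {of_nat p})"
    using eis_frobenius_square[OF assms(1,2), of x] prime_square_eq_euler_exponent[OF assms(1,2)]
    by simp
  then show ?thesis using assms(3) by (rule ideal_cong_eis_mult_cancel)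
qed

lemma (in cubic_character) gauss_power_prime_square:
  assumes p: "prime p" "p \<noteq> 3" and coprime: "coprime p q"
  shows "[gauss ^ p\<^sup>2 = smult (chi (int p)) gauss] (ideal (group_ideal q p))"
  unfolding group_sum_smult [symmetric]
proof (rule ideal_cong_group_sum_power_prime_power)
  let ?c = "chi (int p)"
  show "residue_periodic q (\<lambda>a. ?c * chi a)" using chi_periodic by (rule residue_periodic_comp)
  fix a
  have "chi a ^ p\<^sup>2 = chi a"
  proof (cases "int q dvd a")
    case False
    then have "chi a ^ p\<^sup>2 = chi a ^ 1"
      by (intro cube_roots_power_cong chi_in_cube_roots)
         (simp_all add: coprime_q_iff prime_square_eq_euler_exponent[OF p] cong_def)
    then show ?thesis by simp
  qed (simp add: chi_eq_0 prime_square_eq_euler_exponent[OF p])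
  moreover have "?c * chi (int (p\<^sup>2) * a) = ?c ^ 3 * chi a"
    by (simp add: chi_mult power2_eq_square power3_eq_cube mult_ac)
  moreover have "?c ^ 3 = 1" using coprime by (intro cube_roots_cubed chi_in_cube_roots) simp
  ultimately show "?c * chi (int (p\<^sup>2) * a) = chi a ^ p\<^sup>2" by simp
qed (use p coprime q_pos in auto)

text \<open>
  By Frobenius the \<open>p\<^sup>2\<close>-th power multiplies the Gauss sum by \<open>\<chi>(p)\<close>, and because of \<open>p\<^sup>2 = 3 E + 1\<close>
  it multiplies it by \<open>(J q)\<^sup>E\<close>.
\<close>

theorem (in cubic_character) euler_cubic_jacobi_sum:
  assumes p: "prime p" "p \<noteq> 3" and "p \<noteq> q"
  shows "euler_cubic p jacobi_sum (chi (int p))"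
proof -
  let ?J = jacobi_sum and ?c = "chi (int p)" and ?E = "euler_exponent (int p)"
  let ?P = "{of_nat p} :: eis set"
  have coprime: "coprime p q" by (rule coprime_prime_q) fact+
  then have "[smult ((?J * of_nat q) ^ ?E) gauss = smult ?c gauss] (ideal (group_ideal q p))"
    using gauss_power[where m = ?E and n = p] gauss_power_prime_square[OF p]
    unfolding prime_square_eq_euler_exponent[OF p] by (meson ideal_cong_sym ideal_cong_trans)
  from ideal_cong_residue_coeff[OF this, of 1]
  have eval: "[(?J * of_nat q) ^ ?E = ?c] (ideal ?P)"
    unfolding residue_coeff_smult residue_coeff_gauss by simp
  have "coprime (int p) (eis_norm ?J)" using coprime by (simp add: eis_norm_jacobi_sum)
  then have "[?J ^ (3 * ?E) = 1] (ideal ?P)" by (rule eis_power_euler_exponent[OF p])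
  from ideal_cong_mult_right[OF ideal_cong_sym[OF this], of "eis_cnj ?J ^ ?E"]
  have "[eis_cnj ?J ^ ?E = ?J ^ (3 * ?E) * eis_cnj ?J ^ ?E] (ideal ?P)" by simp
  also have "?J ^ (3 * ?E) * eis_cnj ?J ^ ?E = (?J * of_nat q) ^ ?E * ?J ^ ?E"
    unfolding jacobi_sum_mult_cnj [symmetric] power_mult
    by (simp add: power_mult_distrib power3_eq_cube mult_ac)
  also have "[\<dots> = ?c * ?J ^ ?E] (ideal ?P)" using eval by (rule ideal_cong_mult_right)
  finally show ?thesis by (simp only: euler_cubic_def)
qed

section \<open>Cubic residue symbols for composite moduli\<close>

text \<open>
  \<open>f\<close> is the cubic residue symbol \<open>n \<mapsto> (n/z)\<^sub>3\<close> restricted to rational integers, characterised by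
  periodicity modulo the norm of \<open>z\<close> and by reciprocity at primes.
\<close>

locale cubic_symbol =
  fixes z :: eis and f :: "int \<Rightarrow> eis"
  assumes symbol_mult: "f (m * n) = f m * f n"
    and symbol_in_cube_roots: "coprime n (eis_norm z) \<Longrightarrow> f n \<in> cube_roots"
    and symbol_cong: "[m = n] (mod eis_norm z) \<Longrightarrow> f m = f n"
    and euler_cubic_symbol:
      "prime p \<Longrightarrow> p \<noteq> 3 \<Longrightarrow> coprime (int p) (eis_norm z) \<Longrightarrow> euler_cubic p z (f (int p))"
begin

lemma symbol_1: "f 1 = 1"
  by (rule cube_roots_idempotent) (simp_all add: symbol_in_cube_roots flip: symbol_mult)

lemma symbol_power: "f (n ^ k) = f n ^ k"
  by (induction k) (simp_all add: symbol_1 symbol_mult)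

lemma symbol_minus_1: "f (- 1) = 1"
proof -
  have "(f (- 1))\<^sup>2 = 1" by (simp add: symbol_1 flip: symbol_power)
  moreover have "f (- 1) \<in> cube_roots" by (rule symbol_in_cube_roots) simp
  ultimately show ?thesis by (simp add: cube_roots_square_eq_1)
qed

lemma symbol_eqI:
  assumes "prime p" "p \<noteq> 3" and "coprime (int p) (eis_norm z)"
    and "u \<in> cube_roots" and "euler_cubic p z u"
  shows "f (int p) = u"
  using assms by (intro euler_cubic_unique[of p z] euler_cubic_symbol symbol_in_cube_roots)

end

lemma cubic_symbol_of_int: "cubic_symbol (of_int n) (\<lambda>_. 1)"
  by unfold_locales (simp_all add: euler_cubic_of_int)

lemma cubic_symbol_times:
  assumes "cubic_symbol x f" and "cubic_symbol y g"
  shows "cubic_symbol (x * y) (\<lambda>n. f n * g n)"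
proof -
  interpret f: cubic_symbol x f by fact
  interpret g: cubic_symbol y g by fact
  show ?thesis
  proof
    fix m n :: int assume "[m = n] (mod eis_norm (x * y))"
    then have "[m = n] (mod eis_norm x)" "[m = n] (mod eis_norm y)"
      by (auto intro: cong_dvd_modulus)
    then show "f m * g m = f n * g n" using f.symbol_cong g.symbol_cong by metis
  qed (auto simp: f.symbol_mult g.symbol_mult coprime_mult_right_iff mult_ac intro!:
      cube_roots_mult f.symbol_in_cube_roots g.symbol_in_cube_roots
      euler_cubic_mult f.euler_cubic_symbol g.euler_cubic_symbol)
qed

lemma cubic_symbol_cnj:
  assumes "cubic_symbol z f"
  shows "cubic_symbol (eis_cnj z) (\<lambda>n. eis_cnj (f n))"
proof -
  interpret cubic_symbol z f by fact
  have "eis_cnj u \<in> cube_roots" if "u \<in> cube_roots" for u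
    using that by (simp add: cube_roots_cnj cube_roots_power)
  then show ?thesis
    by unfold_locales (auto simp: symbol_mult symbol_in_cube_roots euler_cubic_cnj euler_cubic_symbol
        dest: symbol_cong)
qed

lemma (in cubic_character) cubic_symbol_jacobi_sum: "cubic_symbol jacobi_sum chi"
proof
  fix p assume "prime p" "p \<noteq> 3" "coprime (int p) (eis_norm jacobi_sum)"
  moreover from this have "p \<noteq> q" using q_gt_1 by (auto simp: eis_norm_jacobi_sum)
  ultimately show "euler_cubic p jacobi_sum (chi (int p))" by (intro euler_cubic_jacobi_sum)
qed (simp_all add: eis_norm_jacobi_sum chi_mult chi_in_cube_roots chi_cong)

text \<open>Up to sign this is the usual normalisation \<open>z \<equiv> - 1\<close> modulo 3.\<close>

definition primary :: "eis \<Rightarrow> bool" where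
  "primary z \<longleftrightarrow> \<not> 3 dvd eis_fst z \<and> 3 dvd eis_snd z"

lemma primary_of_nat: "primary (of_nat n) \<longleftrightarrow> \<not> 3 dvd int n"
  by (simp add: primary_def)

lemma primary_cnj: "primary z \<Longrightarrow> primary (eis_cnj z)"
  by (auto simp: primary_def dvd_diff_left_iff dvd_diff_right_iff)

lemma primary_mult_iff:
  assumes "primary x"
  shows "primary (x * y) \<longleftrightarrow> primary y"
proof -
  have x: "\<not> 3 dvd eis_fst x" "3 dvd eis_snd x" using assms by (simp_all add: primary_def)
  have "eis_snd (x * y) = eis_fst x * eis_snd y + eis_snd x * (eis_fst y - eis_snd y)"
    by (simp add: algebra_simps)
  then have "3 dvd eis_snd (x * y) \<longleftrightarrow> 3 dvd eis_fst x * eis_snd y"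
    using x(2) by (simp only: dvd_add_left_iff dvd_mult2)
  moreover have "3 dvd eis_fst (x * y) \<longleftrightarrow> 3 dvd eis_fst x * eis_fst y"
    using x(2) by (simp add: dvd_diff_left_iff)
  ultimately show ?thesis using x(1) by (simp add: primary_def prime_dvd_mult_iff)
qed

lemma not_3_dvd_norm_if_primary:
  assumes "primary z"
  shows "\<not> 3 dvd eis_norm z"
proof
  assume "3 dvd eis_norm z"
  moreover have "3 dvd eis_snd z * (eis_snd z - eis_fst z)" using assms by (simp add: primary_def)
  ultimately have "3 dvd eis_norm z - eis_snd z * (eis_snd z - eis_fst z)" by (rule dvd_diff)
  then have "3 dvd (eis_fst z)\<^sup>2"
    by (simp add: eis_norm_def power2_eq_square algebra_simps)
  then show False using assms prime_dvd_power[of "3 :: int"] by (simp add: primary_def)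
qed

lemma primary_eq_of_int_if_norm_1:
  assumes "primary z" and "eis_norm z = 1"
  shows "z = of_int (eis_fst z)"
proof -
  obtain b where b: "eis_snd z = 3 * b" using assms(1) by (auto simp: primary_def)
  have "(2 * eis_fst z - 3 * b)\<^sup>2 + 27 * b\<^sup>2 = 4"
    using eis_norm_times_4[of z] assms(2) by (simp add: b power_mult_distrib)
  moreover have "(2 * eis_fst z - 3 * b)\<^sup>2 \<ge> 0" by simp
  ultimately have "27 * b\<^sup>2 \<le> 4" by linarith
  then have "b = 0" using zero_less_power2[of b] by linarith
  then show ?thesis by (simp add: eis_eq_iff b)
qed

lemma (in cubic_character) primary_jacobi_sum: "primary jacobi_sum"
proof -
  have "3 dvd eis_fst jacobi_sum + 1" "3 dvd eis_snd jacobi_sum"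
    using jacobi_sum_mod_3 unfolding ideal_cong_singleton_iff of_nat_dvd_eis_iff by simp_all
  then show ?thesis using dvd_add_right_iff[of 3 "eis_fst jacobi_sum" 1] by (auto simp: primary_def)
qed

lemma of_nat_dvd_eis_if_dvd_norm:
  assumes "prime q" and "int q dvd eis_norm x" and "int q dvd eis_snd x"
  shows "of_nat q dvd x"
proof -
  have "int q dvd eis_norm x - eis_snd x * (eis_snd x - eis_fst x)"
    using assms(2,3) by (intro dvd_diff dvd_mult2)
  then have "int q dvd (eis_fst x)\<^sup>2" by (simp add: eis_norm_def power2_eq_square algebra_simps)
  then have "int q dvd eis_fst x" using assms(1) prime_dvd_power[of "int q"] by simp
  with assms(3) show ?thesis by (simp add: of_nat_dvd_eis_iff)
qed

lemma dvd_or_cnj_dvd_if_norm_prime: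
  assumes "prime q" and x: "eis_norm x = int q" and z: "int q dvd eis_norm z"
  shows "x dvd z \<or> eis_cnj x dvd z"
proof -
  have dvd: "y dvd z" if "eis_norm y = int q" "int q dvd eis_snd (z * eis_cnj y)" for y
  proof -
    have "of_nat q dvd z * eis_cnj y"
      using assms(1) z that by (intro of_nat_dvd_eis_if_dvd_norm) simp_all
    moreover have "of_nat q = y * eis_cnj y" using that(1) by (simp add: eis_mult_cnj)
    moreover have "eis_cnj y \<noteq> 0"
      using that(1) prime_gt_0_nat[OF assms(1)] eis_norm_pos_iff[of y] by simp
    ultimately show ?thesis by simp
  qed
  have "eis_snd (z * eis_cnj x) * eis_snd (z * x) =
      (eis_snd z)\<^sup>2 * eis_norm x - (eis_snd x)\<^sup>2 * eis_norm z"
    by (simp add: eis_norm_def power2_eq_square algebra_simps)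
  also have "int q dvd \<dots>" using z by (simp add: x dvd_diff)
  finally have "int q dvd eis_snd (z * eis_cnj x) \<or> int q dvd eis_snd (z * x)"
    using assms(1) by (simp add: prime_dvd_mult_iff)
  then show ?thesis using dvd[of x] dvd[of "eis_cnj x"] x by auto
qed

text \<open>For an inert prime \<open>q\<close> the norm of \<open>z\<close> is \<open>z\<^sup>q\<^sup>+\<^sup>1\<close> modulo \<open>q\<close>, so if it vanishes then so does the
  \<open>q\<^sup>2\<close>-th power of \<open>z\<close>, which is \<open>z\<close> itself.\<close>

lemma prime_dvd_norm_mod_3:
  assumes "prime q" "q \<noteq> 3" and "int q dvd eis_norm z" and "\<not> of_nat q dvd z"
  shows "q mod 3 = 1"
  using assms(1,2)
proof (cases rule: prime_mod_3_cases)
  case inert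
  let ?Q = "{of_nat q} :: eis set"
  have "[z * z ^ q = z * eis_cnj z] (ideal ?Q)"
    by (intro ideal_cong_mult_left eis_frobenius_inert assms(1) inert)
  also have "[z * eis_cnj z = 0] (ideal ?Q)"
    using assms(3) by (simp add: eis_mult_cnj ideal_cong_eis_iff cong_0_iff)
  finally have zero: "[z * z ^ q = 0] (ideal ?Q)" .
  have "q\<^sup>2 = Suc q + (q\<^sup>2 - Suc q)"
    using prime_ge_2_nat[OF assms(1)] by (simp add: power2_eq_square Suc_le_eq)
  then have "z ^ q\<^sup>2 = z * z ^ q * z ^ (q\<^sup>2 - Suc q)" by (metis power_Suc power_add)
  moreover have "[z * z ^ q * z ^ (q\<^sup>2 - Suc q) = 0 * z ^ (q\<^sup>2 - Suc q)] (ideal ?Q)"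
    using zero by (rule ideal_cong_mult_right)
  ultimately have "[z = 0] (ideal ?Q)"
    using eis_frobenius_square[OF assms(1,2), of z] ideal_cong_sym ideal_cong_trans by fastforce
  with assms(4) show ?thesis by (simp add: ideal_cong_singleton_iff)
qed

lemma primary_factor_with_symbol:
  assumes "primary z" and "eis_norm z > 1"
  obtains x f where "x dvd z" "cubic_symbol x f" "primary x" "eis_norm x > 1"
proof -
  have "nat (eis_norm z) \<noteq> 1" using assms(2) by linarith
  then obtain q where q: "prime q" "q dvd nat (eis_norm z)" using prime_factor_nat by blast
  then have dvd: "int q dvd eis_norm z" using assms(2) by (simp add: int_dvd_int_iff [symmetric])
  then have "q \<noteq> 3" using not_3_dvd_norm_if_primary[OF assms(1)] by auto
  have "q > 1" using q(1) by (rule prime_gt_1_nat)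
  show thesis
  proof (cases "(of_nat q :: eis) dvd z")
    case True
    moreover have "cubic_symbol (of_nat q) (\<lambda>_. 1)" using cubic_symbol_of_int[of "int q"] by simp
    moreover have "\<not> 3 dvd int q"
      using not_3_dvd_norm_if_primary[OF assms(1)] dvd by (meson dvd_trans)
    ultimately show thesis using \<open>q > 1\<close>
      by (intro that[of "of_nat q"]) (simp_all add: primary_of_nat one_less_power)
  next
    case False
    with q(1) \<open>q \<noteq> 3\<close> dvd have "q mod 3 = 1" by (rule prime_dvd_norm_mod_3)
    then obtain chi where "cubic_character q chi" using cubic_character_exists q(1) by blast
    then interpret cubic_character q chi .
    have "jacobi_sum dvd z \<or> eis_cnj jacobi_sum dvd z"
      using q(1) eis_norm_jacobi_sum dvd by (rule dvd_or_cnj_dvd_if_norm_prime)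
    then show thesis
      using that cubic_symbol_jacobi_sum cubic_symbol_cnj primary_jacobi_sum primary_cnj
        eis_norm_jacobi_sum q_gt_1 by fastforce
  qed
qed

theorem cubic_symbol_exists:
  assumes "primary z"
  shows "\<exists>f. cubic_symbol z f"
  using assms
proof (induction "nat (eis_norm z)" arbitrary: z rule: less_induct)
  case less
  have "z \<noteq> 0" using less.prems by (auto simp: primary_def)
  then have pos: "eis_norm z > 0" by simp
  show ?case
  proof (cases "eis_norm z = 1")
    case True
    with less.prems show ?thesis using primary_eq_of_int_if_norm_1 cubic_symbol_of_int by metis
  next
    case False
    then obtain x f where x: "x dvd z" "cubic_symbol x f" "primary x" "eis_norm x > 1"
      using primary_factor_with_symbol[OF less.prems] pos by auto
    then obtain y where y: "z = x * y" by (elim dvdE)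
    then have "eis_norm y > 0" using \<open>z \<noteq> 0\<close> by simp
    then have "eis_norm y < eis_norm z" using x(4) by (simp add: y)
    then have "nat (eis_norm y) < nat (eis_norm z)" using pos by simp
    moreover have "primary y" using less.prems x(3) by (simp add: y primary_mult_iff)
    ultimately obtain g where "cubic_symbol y g" using less.hyps by blast
    then show ?thesis using cubic_symbol_times[OF x(2)] y by blast
  qed
qed

definition omega_symbol :: "int \<Rightarrow> eis" where
  "omega_symbol n = \<omega> ^ euler_exponent n"

lemma omega_symbol_mult:
  assumes "\<not> 3 dvd m" "\<not> 3 dvd n"
  shows "omega_symbol (m * n) = omega_symbol m * omega_symbol n"
proof -
  let ?e = "\<lambda>n. int (euler_exponent n)"
  have "\<not> 3 dvd m * n" using assms by (simp add: prime_dvd_mult_iff)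
  from three_times_euler_exponent[OF this] have "3 * ?e (m * n) + 1 = m\<^sup>2 * n\<^sup>2"
    by (simp add: power_mult_distrib)
  also have "\<dots> = (3 * ?e m + 1) * (3 * ?e n + 1)"
    using assms by (simp add: three_times_euler_exponent)
  finally have "?e (m * n) = ?e m + ?e n + 3 * (?e m * ?e n)" by (simp add: algebra_simps)
  then have "[?e (m * n) = int (euler_exponent m + euler_exponent n)] (mod int 3)"
    by (simp add: cong_def)
  then have "[euler_exponent (m * n) = euler_exponent m + euler_exponent n] (mod 3)"
    by (simp only: cong_int_iff)
  then have "\<omega> ^ euler_exponent (m * n) = \<omega> ^ (euler_exponent m + euler_exponent n)"
    by (intro cube_roots_power_cong) (simp add: cube_roots_def)
  then show ?thesis by (simp add: omega_symbol_def power_add)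
qed

lemma omega_symbol_cong:
  assumes "[m = n] (mod 9)" "\<not> 3 dvd n"
  shows "omega_symbol m = omega_symbol n"
proof -
  let ?e = "\<lambda>n. int (euler_exponent n)"
  have "[m = n] (mod 3)" using assms(1) by (rule cong_dvd_modulus) simp
  then have "\<not> 3 dvd m" using assms(2) cong_dvd_iff by blast
  then have "m\<^sup>2 - n\<^sup>2 = 3 * (?e m - ?e n)"
    using three_times_euler_exponent[of m] three_times_euler_exponent[OF assms(2)] by simp
  moreover have "9 dvd m\<^sup>2 - n\<^sup>2"
    using cong_pow[OF assms(1), of 2] by (simp add: cong_iff_dvd_diff)
  ultimately have "3 * 3 dvd 3 * (?e m - ?e n)" by simp
  then have "[?e m = ?e n] (mod int 3)"
    unfolding dvd_mult_cancel_left by (simp add: cong_iff_dvd_diff)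
  then have "[euler_exponent m = euler_exponent n] (mod 3)" by (simp only: cong_int_iff)
  then show ?thesis
    unfolding omega_symbol_def by (intro cube_roots_power_cong) (simp_all add: cube_roots_def)
qed

context cubic_symbol
begin

lemma symbol_prime_eq_omega_symbol:
  assumes l: "prime l" "l \<noteq> 3" and cop: "coprime (int l) (eis_norm z)"
    and cnj: "[eis_cnj z = - (\<omega> ^ j * z)] (ideal {of_nat l})"
  shows "f (int l) = omega_symbol (int l) ^ j"
proof (rule symbol_eqI[OF l cop])
  let ?E = "euler_exponent (int l)" and ?L = "{of_nat l} :: eis set"
  have "[(- 1) ^ ?E = (1 :: eis)] (ideal ?L)"
  proof (cases "l = 2")
    case True
    then show ?thesis by (simp add: euler_exponent_def ideal_cong_singleton_iff)
  next
    case False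
    then have "odd (l\<^sup>2)" using prime_odd_nat[OF l(1)] prime_ge_2_nat[OF l(1)] by simp
    then have "even ?E" unfolding prime_square_eq_euler_exponent[OF l] by simp
    then show ?thesis by simp
  qed
  then have "[(- 1) ^ ?E * ((\<omega> ^ j) ^ ?E * z ^ ?E) = 1 * ((\<omega> ^ j) ^ ?E * z ^ ?E)] (ideal ?L)"
    by (rule ideal_cong_mult_right)
  then have "[(- (\<omega> ^ j * z)) ^ ?E = (\<omega> ^ j) ^ ?E * z ^ ?E] (ideal ?L)"
    unfolding power_minus[of "\<omega> ^ j * z"] power_mult_distrib by simp
  with ideal_cong_power[OF cnj] have "[eis_cnj z ^ ?E = (\<omega> ^ j) ^ ?E * z ^ ?E] (ideal ?L)"
    by (rule ideal_cong_trans)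
  then show "euler_cubic l z (omega_symbol (int l) ^ j)"
    by (simp add: euler_cubic_def omega_symbol_def mult.commute flip: power_mult)
qed (simp add: omega_symbol_def cube_roots_power)

lemma symbol_eq_omega_symbol:
  assumes "coprime n (eis_norm z)" "\<not> 3 dvd n" "of_int n dvd eis_cnj z + \<omega> ^ j * z"
  shows "f n = omega_symbol n ^ j"
  using assms
proof (induction n rule: prime_divisors_induct)
  case (unit n)
  then have "n = 1 \<or> n = - 1" by auto
  then show ?case by (auto simp: symbol_1 symbol_minus_1 omega_symbol_def euler_exponent_def)
next
  case (factor p n)
  obtain l where "p = int l" using prime_ge_0_int[OF factor(1)] nonneg_int_cases by blast
  with factor(1) have l: "p = int l" "prime l" by auto
  have cop: "coprime p (eis_norm z)" "coprime n (eis_norm z)"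
    using factor.prems(1) by (simp_all add: coprime_mult_left_iff)
  have n3: "\<not> 3 dvd p" "\<not> 3 dvd n" using factor.prems(2) by (blast intro: dvd_mult dvd_mult2)+
  have "of_int p * of_int n dvd eis_cnj z + \<omega> ^ j * z" using factor.prems(3) by simp
  then have dvd: "of_int p dvd eis_cnj z + \<omega> ^ j * z" "of_int n dvd eis_cnj z + \<omega> ^ j * z"
    by (rule dvd_mult_left, rule dvd_mult_right)
  have "f n = omega_symbol n ^ j" using cop(2) n3(2) dvd(2) by (rule factor.IH)
  moreover have "l \<noteq> 3" using n3(1) l(1) by auto
  then have "f p = omega_symbol p ^ j"
    using l cop(1) dvd(1) unfolding l(1)
    by (intro symbol_prime_eq_omega_symbol) (simp_all add: ideal_cong_singleton_iff)
  moreover have "omega_symbol (p * n) = omega_symbol p * omega_symbol n"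
    using n3 by (rule omega_symbol_mult)
  ultimately show ?case by (simp add: symbol_mult power_mult_distrib)
qed simp

text \<open>For \<open>z = a + b \<omega>\<close> one has \<open>(a - 2b)(a + b) \<equiv> -3b\<^sup>2\<close> modulo the norm, and modulo the factors on
  the left \<open>z\<close> is a rational multiple of \<open>2 + \<omega>\<close> and \<open>\<omega> - 1\<close>, so their symbols are known.\<close>

lemma symbol_3_times_square:
  assumes "9 dvd eis_snd z" "\<not> 3 dvd eis_fst z" and cop: "coprime (3 * (eis_snd z)\<^sup>2) (eis_norm z)"
  shows "f (3 * (eis_snd z)\<^sup>2) = 1"
proof -
  define a b where ab: "a = eis_fst z" "b = eis_snd z"
  have "(a - 2 * b) * (a + b) - (- 1 * (3 * b\<^sup>2)) = eis_norm z"
    by (simp add: eis_norm_def ab power2_eq_square algebra_simps)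
  then have cong: "[(a - 2 * b) * (a + b) = - 1 * (3 * b\<^sup>2)] (mod eis_norm z)"
    by (simp add: cong_iff_dvd_diff)
  have "coprime (- 1 * (3 * b\<^sup>2)) (eis_norm z)" using cop by (simp add: ab)
  with cong have "coprime ((a - 2 * b) * (a + b)) (eis_norm z)"
    by (metis cong_imp_coprime cong_sym)
  then have coprime: "coprime (a - 2 * b) (eis_norm z)" "coprime (a + b) (eis_norm z)" by simp_all
  obtain c where c: "b = 9 * c" using assms(1) by (auto simp: ab)
  have not_3_dvd: "\<not> 3 dvd a - 2 * b" "\<not> 3 dvd a + b" "\<not> 3 dvd a"
    using assms(2) unfolding c ab(1) [symmetric] by presburger+
  have omega_symbol: "omega_symbol (a - 2 * b) = omega_symbol a"
      "omega_symbol (a + b) = omega_symbol a"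
    using not_3_dvd(3) by (auto intro!: omega_symbol_cong simp: c cong_iff_dvd_diff)
  have "eis_cnj z + \<omega> ^ 1 * z = of_int (a - 2 * b) * (1 + \<omega>)"
    by (simp add: eis_eq_iff ab algebra_simps)
  then have "of_int (a - 2 * b) dvd eis_cnj z + \<omega> ^ 1 * z" by (simp only: dvd_triv_left)
  with coprime(1) not_3_dvd(1) have "f (a - 2 * b) = omega_symbol (a - 2 * b) ^ 1"
    by (rule symbol_eq_omega_symbol)
  moreover have "eis_cnj z + \<omega> ^ 2 * z = of_int (a + b) * (- \<omega>)"
    by (simp add: eis_eq_iff ab power2_eq_square algebra_simps)
  then have "of_int (a + b) dvd eis_cnj z + \<omega> ^ 2 * z" by (simp only: dvd_triv_left)
  with coprime(2) not_3_dvd(2) have "f (a + b) = omega_symbol (a + b) ^ 2"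
    by (rule symbol_eq_omega_symbol)
  ultimately have "f ((a - 2 * b) * (a + b)) = omega_symbol a ^ 3"
    by (simp add: symbol_mult omega_symbol power2_eq_square power3_eq_cube)
  also have "\<dots> = 1" unfolding omega_symbol_def by (rule cube_roots_cubed) simp
  finally have "f (- 1 * (3 * b\<^sup>2)) = 1" using symbol_cong[OF cong] by simp
  then show ?thesis unfolding symbol_mult[of "- 1"] symbol_minus_1 by (simp add: ab)
qed

end

section \<open>Morgan-Voyce polynomials\<close>

definition morgan_voyce :: "nat \<Rightarrow> 'a :: comm_ring_1 \<Rightarrow> 'a" where
  "morgan_voyce n x = (\<Sum>k\<le>n. of_nat ((n + k) choose (2 * k)) * x ^ k)"

lemma of_int_morgan_voyce: "of_int (morgan_voyce n x) = morgan_voyce n (of_int x)"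
  by (simp add: morgan_voyce_def)

lemma morgan_voyce_eq_sum:
  assumes "n \<le> m"
  shows "morgan_voyce n x = (\<Sum>k\<le>m. of_nat ((n + k) choose (2 * k)) * x ^ k)"
  unfolding morgan_voyce_def
  by (rule sum.mono_neutral_left) (use assms in \<open>auto simp: binomial_eq_0\<close>)

lemma binomial_second_difference:
  "((n + 2 + Suc k) choose (2 * Suc k)) + ((n + Suc k) choose (2 * Suc k)) =
     2 * ((n + 1 + Suc k) choose (2 * Suc k)) + ((n + 1 + k) choose (2 * k))"
  by (simp add: numeral_2_eq_2)

lemma morgan_voyce_rec:
  "morgan_voyce (n + 2) x = (x + 2) * morgan_voyce (n + 1) x - morgan_voyce n x"
proof -
  let ?b = "\<lambda>m k. of_nat ((m + k) choose (2 * k)) :: 'a"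
  have diff: "?b (n + 2) (Suc k) + ?b n (Suc k) - 2 * ?b (n + 1) (Suc k) = ?b (n + 1) k" for k
    using arg_cong[OF binomial_second_difference[of n k], of "of_nat :: nat \<Rightarrow> 'a"]
    by (simp only: of_nat_add of_nat_mult of_nat_numeral) simp
  have "morgan_voyce (n + 2) x + morgan_voyce n x - 2 * morgan_voyce (n + 1) x =
      (\<Sum>k\<le>n + 2. (?b (n + 2) k + ?b n k - 2 * ?b (n + 1) k) * x ^ k)"
    by (simp add: morgan_voyce_eq_sum[of _ "n + 2"] sum.distrib sum_subtractf sum_distrib_left
        left_diff_distrib distrib_right mult.assoc)
  also have "\<dots> = (\<Sum>k\<le>Suc (n + 1). (?b (n + 2) k + ?b n k - 2 * ?b (n + 1) k) * x ^ k)"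
    by simp
  also have "\<dots> = (\<Sum>k\<le>n + 1. ?b (n + 1) k * x ^ Suc k)"
    by (subst sum.atMost_Suc_shift) (simp only: diff, simp)
  also have "\<dots> = x * morgan_voyce (n + 1) x"
    unfolding morgan_voyce_def sum_distrib_left by (simp only: power_Suc mult_ac)
  finally show ?thesis by (simp add: algebra_simps)
qed

lemma morgan_voyce_closed_form:
  assumes "[z\<^sup>2 + w\<^sup>2 = (x + 2) * (z * w)] (ideal S)"
  shows "[morgan_voyce n x * (z * w) ^ n * (z + w) = z ^ (2 * n + 1) + w ^ (2 * n + 1)] (ideal S)"
proof (induction n rule: induct_nat_012)
  case 0
  show ?case by (simp add: morgan_voyce_def)
next
  case 1
  have "morgan_voyce (Suc 0) x = 1 + x" by (simp add: morgan_voyce_def numeral_2_eq_2)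
  then have "morgan_voyce (Suc 0) x * (z * w) ^ Suc 0 * (z + w) =
      ((x + 2) * (z * w) - z * w) * (z + w)"
    by (simp add: algebra_simps)
  also have "[\<dots> = (z\<^sup>2 + w\<^sup>2 - z * w) * (z + w)] (ideal S)"
    by (intro ideal_cong_mult_right ideal_cong_diff ideal_cong_refl ideal_cong_sym[OF assms])
  also have "\<dots> = z ^ (2 * Suc 0 + 1) + w ^ (2 * Suc 0 + 1)"
    by (simp add: algebra_simps power2_eq_square power3_eq_cube numeral_3_eq_3)
  finally show ?case .
next
  case (ge2 n)
  let ?D = "\<lambda>n. z ^ (2 * n + 1) + w ^ (2 * n + 1)"
  let ?T = "\<lambda>n. morgan_voyce n x * (z * w) ^ n * (z + w)"
  have rec: "morgan_voyce (Suc (Suc n)) x = (x + 2) * morgan_voyce (Suc n) x - morgan_voyce n x"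
    using morgan_voyce_rec[of n x] by simp
  have "?T (Suc (Suc n)) = (x + 2) * (z * w) * ?T (Suc n) - (z * w)\<^sup>2 * ?T n"
    unfolding rec by (simp add: algebra_simps power2_eq_square)
  also have "[\<dots> = (z\<^sup>2 + w\<^sup>2) * ?D (Suc n) - (z * w)\<^sup>2 * ?D n] (ideal S)"
    by (intro ideal_cong_diff ideal_cong_mult ideal_cong_refl ge2 ideal_cong_sym[OF assms])
  also have "\<dots> = ?D (Suc (Suc n))" by (simp add: power2_eq_square algebra_simps)
  finally show ?case .
qed

lemma Suc_times_binomial_Suc: "Suc k * (n choose Suc k) = (n - k) * (n choose k)"
  by (simp only: binomial_absorption binomial_absorb_comp)

lemma binomial_times_fact_eq_prod:
  "int ((n + k) choose (2 * k)) * fact (2 * k) =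
     (\<Prod>j<k. int n * (int n + 1) - int j * (int j + 1))"
proof (induction k)
  case (Suc k)
  let ?b = "(n + k) choose (2 * k)"
  have "(2 * k + 2) * ((n + Suc k) choose (2 * Suc k)) = (n + k + 1) * ((n + k) choose (2 * k + 1))"
    using Suc_times_binomial[of "2 * k + 1" "n + k"] by (simp del: binomial_Suc_Suc)
  then have "(2 * k + 1) * ((2 * k + 2) * ((n + Suc k) choose (2 * Suc k))) =
      (n + k + 1) * ((2 * k + 1) * ((n + k) choose (2 * k + 1)))"
    by (simp only: mult.left_commute)
  also have "(2 * k + 1) * ((n + k) choose (2 * k + 1)) = (n + k - 2 * k) * ?b"
    using Suc_times_binomial_Suc[of "2 * k" "n + k"] by simp
  finally have "int ((2 * k + 1) * ((2 * k + 2) * ((n + Suc k) choose (2 * Suc k)))) =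
      int (n + k + 1) * int ((n + k - 2 * k) * ?b)"
    by (simp only: of_nat_mult)
  also have "int ((n + k - 2 * k) * ?b) = (int n - int k) * int ?b"
    by (cases "k \<le> n") (simp_all add: of_nat_diff binomial_eq_0)
  finally have step: "(2 * int k + 1) * ((2 * int k + 2) * int ((n + Suc k) choose (2 * Suc k))) =
      (int n * (int n + 1) - int k * (int k + 1)) * int ?b"
    by (simp add: algebra_simps del: binomial_Suc_Suc)
  have "fact (2 * Suc k) = (2 * int k + 1) * (2 * int k + 2) * fact (2 * k)"
    by (simp add: algebra_simps)
  then have "int ((n + Suc k) choose (2 * Suc k)) * fact (2 * Suc k) =
      (2 * int k + 1) * ((2 * int k + 2) * int ((n + Suc k) choose (2 * Suc k))) * fact (2 * k)"
    by (simp only: mult_ac)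
  also have "\<dots> = (int n * (int n + 1) - int k * (int k + 1)) * (int ?b * fact (2 * k))"
    unfolding step by (simp only: mult.assoc)
  finally show ?case unfolding Suc by (simp only: prod.lessThan_Suc mult.commute)
qed simp

lemma fact_triple_eq_prod:
  "(fact (3 * k) :: int) = fact k * (\<Prod>j<k. 3 * (9 * (int j * (int j + 1)) + 2))"
proof (induction k)
  case (Suc k)
  have "3 * Suc k = Suc (Suc (Suc (3 * k)))" by simp
  then have "(fact (3 * Suc k) :: int) =
      (3 * int k + 3) * ((3 * int k + 2) * ((3 * int k + 1) * fact (3 * k)))"
    by (simp only: fact_Suc) (simp add: algebra_simps)
  also have "\<dots> = (int k + 1) * (3 * (9 * (int k * (int k + 1)) + 2)) * fact (3 * k)"
    by (simp add: algebra_simps)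
  finally show ?case unfolding Suc by (simp add: mult_ac)
qed simp

lemma binomial_triple_times_fact_eq_prod:
  "int ((3 * k) choose k) * fact (2 * k) = (\<Prod>j<k. 3 * (9 * (int j * (int j + 1)) + 2))"
proof -
  have "fact k * fact (3 * k - k) * ((3 * k) choose k) = fact (3 * k)"
    by (rule binomial_fact_lemma) simp
  then have "int (fact k * fact (2 * k) * ((3 * k) choose k)) = int (fact (3 * k))" by simp
  then have "fact k * (fact (2 * k) * int ((3 * k) choose k)) =
      fact k * (\<Prod>j<k. 3 * (9 * (int j * (int j + 1)) + 2))"
    by (simp add: fact_triple_eq_prod mult.assoc)
  then show ?thesis by (simp add: mult.commute)
qed

lemma binomial_triple_cong:
  assumes n: "[9 * (int n * (int n + 1)) = - 2] (mod m)" and "coprime (fact (2 * k)) m"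
  shows "[int ((3 * k) choose k) * (- 1) ^ k = int ((n + k) choose (2 * k)) * 27 ^ k] (mod m)"
proof -
  let ?d = "\<lambda>j. int j * (int j + 1)"
  have "[27 * (?d n - ?d j) = - 1 * (3 * (9 * ?d j + 2))] (mod m)" for j
    using cong_mult[OF cong_refl[of 3] cong_diff[OF n cong_refl[of "9 * ?d j"]]]
    by (simp add: algebra_simps)
  then have "[(\<Prod>j<k. 27 * (?d n - ?d j)) = (\<Prod>j<k. - 1 * (3 * (9 * ?d j + 2)))] (mod m)"
    by (intro cong_prod)
  then have "[27 ^ k * (int ((n + k) choose (2 * k)) * fact (2 * k)) =
      (- 1) ^ k * (int ((3 * k) choose k) * fact (2 * k))] (mod m)"
    unfolding binomial_times_fact_eq_prod binomial_triple_times_fact_eq_prod prod.distrib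
    by simp
  then have "[fact (2 * k) * (int ((n + k) choose (2 * k)) * 27 ^ k) =
      fact (2 * k) * (int ((3 * k) choose k) * (- 1) ^ k)] (mod m)"
    by (simp only: mult_ac)
  then show ?thesis using assms(2) by (simp only: cong_mult_lcancel cong_sym)
qed

lemma binomial_triple_sum_cong:
  assumes "prime p" "p > 3"
  shows "[(\<Sum>k=0..p div 3. int ((3 * k) choose k) * (- 1) ^ k) = morgan_voyce (p div 3) 27]
    (mod int p)"
proof -
  define n where "n = p div 3"
  have "p \<noteq> 3" using assms(2) by simp
  with assms(1) have "[9 * (int n * (int n + 1)) = - 2] (mod int p)"
  proof (cases rule: prime_mod_3_cases)
    case split
    then have "int p = 3 * int n + 1" unfolding n_def by presburger
    then have "9 * (int n * (int n + 1)) - (- 2) = int p * (3 * int n + 2)"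
      by (simp add: algebra_simps)
    then show ?thesis by (simp add: cong_iff_dvd_diff)
  next
    case inert
    then have "int p = 3 * int n + 2" unfolding n_def by presburger
    then have "9 * (int n * (int n + 1)) - (- 2) = int p * (3 * int n + 1)"
      by (simp add: algebra_simps)
    then show ?thesis by (simp add: cong_iff_dvd_diff)
  qed
  moreover have "coprime (fact (2 * k)) (int p)" if "k \<le> n" for k
  proof -
    have "\<not> p dvd fact (2 * k)"
      using assms that by (simp add: n_def prime_dvd_fact_iff)
    then have "coprime p (fact (2 * k))" using assms(1) by (simp add: prime_imp_coprime)
    then have "coprime (int p) (int (fact (2 * k)))" by (simp only: coprime_int_iff)
    then show ?thesis by (simp add: coprime_commute)
  qed
  ultimately show ?thesis
    unfolding morgan_voyce_def atLeast0AtMost n_def [symmetric]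
    by (intro cong_sum) (simp add: binomial_triple_cong)
qed

section \<open>Euler's criterion at split and inert primes\<close>

lemma euler_exponent_eqI: "n\<^sup>2 = 3 * int e + 1 \<Longrightarrow> euler_exponent n = e"
  by (simp add: euler_exponent_def)

lemma euler_exponent_split:
  assumes "p mod 3 = 1"
  shows "euler_exponent (int p) = (p div 3) * (p + 1)"
proof (rule euler_exponent_eqI)
  have "int p = 3 * int (p div 3) + 1" using assms by presburger
  then show "(int p)\<^sup>2 = 3 * int ((p div 3) * (p + 1)) + 1"
    by (simp add: power2_eq_square algebra_simps)
qed

lemma euler_exponent_inert:
  assumes "p mod 3 = 2"
  shows "euler_exponent (int p) = (p div 3 + 1) * (p - 1)"
proof (rule euler_exponent_eqI)
  have p: "int p = 3 * int (p div 3) + 2" using assms by presburger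
  then have "int (p - 1) = 3 * int (p div 3) + 1" by linarith
  with p show "(int p)\<^sup>2 = 3 * int ((p div 3 + 1) * (p - 1)) + 1"
    by (simp add: power2_eq_square algebra_simps)
qed

lemma euler_cubic_splitI:
  assumes "p mod 3 = 1" and "u \<in> cube_roots"
    and cong: "[z ^ (p div 3) = u * eis_cnj z ^ (p div 3)] (ideal {of_nat p})"
  shows "euler_cubic p z u"
proof -
  let ?a = "z ^ (p div 3)" and ?b = "eis_cnj z ^ (p div 3)"
  have "[p + 1 = 2] (mod 3)" using assms(1) unfolding cong_def by presburger
  with assms(2) have "u ^ (p + 1) = u ^ 2" by (rule cube_roots_power_cong)
  then have "u * u ^ (p + 1) = u ^ 3" by (simp only: power2_eq_square power3_eq_cube mult.assoc)
  then have "u * u ^ (p + 1) = 1" by (simp only: cube_roots_cubed[OF assms(2)])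
  then have "?b ^ (p + 1) = u * (u * ?b) ^ (p + 1)"
    by (simp only: power_mult_distrib mult.assoc [symmetric] mult_1_left)
  also have "[\<dots> = u * ?a ^ (p + 1)] (ideal {of_nat p})"
    by (intro ideal_cong_mult_left ideal_cong_power ideal_cong_sym[OF cong])
  finally show ?thesis
    by (simp only: euler_cubic_def euler_exponent_split[OF assms(1)] power_mult)
qed

lemma euler_cubic_inertI:
  assumes "p mod 3 = 2" and "u \<in> cube_roots"
    and cong: "[eis_cnj z ^ (p div 3 + 1) = u * z ^ (p div 3 + 1)] (ideal {of_nat p})"
  shows "euler_cubic p z u"
proof -
  let ?a = "z ^ (p div 3 + 1)" and ?b = "eis_cnj z ^ (p div 3 + 1)"
  obtain n where "p = 3 * n + 2" using assms(1) by (metis mod_mult_div_eq add.commute)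
  then have "[p - 1 = 1] (mod 3)" by (simp add: cong_def)
  with assms(2) have u: "u ^ (p - 1) = u ^ 1" by (rule cube_roots_power_cong)
  have "[?b ^ (p - 1) = (u * ?a) ^ (p - 1)] (ideal {of_nat p})"
    using cong by (rule ideal_cong_power)
  also have "(u * ?a) ^ (p - 1) = u * ?a ^ (p - 1)" unfolding power_mult_distrib u by simp
  finally show ?thesis
    by (simp only: euler_cubic_def euler_exponent_inert[OF assms(1)] power_mult)
qed

lemma power_euler_exponent_split:
  fixes x :: eis
  assumes "prime p" "p mod 3 = 1"
  shows "[x ^ euler_exponent (int p) = x ^ (p div 3) * x ^ (p div 3)] (ideal {of_nat p})"
proof -
  have "x ^ euler_exponent (int p) = (x ^ (p div 3)) ^ p * x ^ (p div 3)"
    by (simp only: euler_exponent_split[OF assms(2)] power_mult power_add power_one_right)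
  also have "[\<dots> = x ^ (p div 3) * x ^ (p div 3)] (ideal {of_nat p})"
    by (intro ideal_cong_mult_right eis_frobenius_split assms)
  finally show ?thesis .
qed

lemma power_euler_exponent_inert:
  assumes "prime p" "p mod 3 = 2"
  shows "[x ^ euler_exponent (int p) * x ^ (p div 3 + 1) = eis_cnj x ^ (p div 3 + 1)]
    (ideal {of_nat p})"
proof -
  have "x ^ euler_exponent (int p) * x ^ (p div 3 + 1) =
      (x ^ (p div 3 + 1)) ^ (p - 1) * x ^ (p div 3 + 1)"
    by (simp only: euler_exponent_inert[OF assms(2)] power_mult)
  also have "\<dots> = (x ^ (p div 3 + 1)) ^ p"
    using prime_gt_0_nat[OF assms(1)] by (rule power_minus_mult)
  also have "[\<dots> = eis_cnj (x ^ (p div 3 + 1))] (ideal {of_nat p})"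
    by (intro eis_frobenius_inert assms)
  finally show ?thesis by simp
qed

lemma power_third_cubed_split:
  assumes "prime p" "p mod 3 = 1" and "coprime (int p) (eis_norm x)"
  shows "[(x ^ (p div 3)) ^ 3 = 1] (ideal {of_nat p})"
proof (rule ideal_cong_eis_mult_cancel)
  have "p = 3 * (p div 3) + 1" using assms(2) by presburger
  then have "x * (x ^ (p div 3)) ^ 3 = x ^ p"
    by (metis add.commute mult.commute plus_1_eq_Suc power_Suc power_mult)
  then show "[x * (x ^ (p div 3)) ^ 3 = x * 1] (ideal {of_nat p})"
    using eis_frobenius_split[OF assms(1,2), of x] by simp
qed fact

lemma power_third_cubed_inert:
  assumes "prime p" "p mod 3 = 2"
  shows "[(x ^ (p div 3 + 1)) ^ 3 = x * eis_cnj x] (ideal {of_nat p})"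
proof -
  define n where "n = p div 3"
  have "p = 3 * n + 2" using assms(2) unfolding n_def by presburger
  then have p: "3 * (n + 1) = Suc p" by simp
  have "(x ^ (n + 1)) ^ 3 = x * x ^ p"
    by (simp only: power_mult [symmetric] mult.commute[of "n + 1"] p power_Suc)
  also have "[\<dots> = x * eis_cnj x] (ideal {of_nat p})"
    by (intro ideal_cong_mult_left eis_frobenius_inert assms)
  finally show ?thesis by (simp only: n_def)
qed

lemma euler_cubic_splitD:
  assumes "prime p" "p mod 3 = 1" and coprime: "coprime (int p) (eis_norm z)"
    and euler: "euler_cubic p z u"
  shows "[z ^ (p div 3) = u * eis_cnj z ^ (p div 3)] (ideal {of_nat p})"
proof -
  let ?P = "{of_nat p} :: eis set" and ?a = "z ^ (p div 3)" and ?b = "eis_cnj z ^ (p div 3)"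
  have cubed: "[?a ^ 3 = 1] (ideal ?P)" "[?b ^ 3 = 1] (ideal ?P)"
    using coprime by (intro power_third_cubed_split assms; simp)+
  note E = power_euler_exponent_split[OF assms(1,2)]
  have square: "[?b * ?b = u * (?a * ?a)] (ideal ?P)"
    using E euler ideal_cong_mult_left[OF E] unfolding euler_cubic_def
    by (meson ideal_cong_sym ideal_cong_trans)
  have "[?a * 1 = ?a * ?b ^ 3] (ideal ?P)"
    by (intro ideal_cong_mult_left ideal_cong_sym[OF cubed(2)])
  also have "?a * ?b ^ 3 = (?a * ?b) * (?b * ?b)" by (simp add: power3_eq_cube mult_ac)
  also have "[\<dots> = (?a * ?b) * (u * (?a * ?a))] (ideal ?P)"
    using square by (rule ideal_cong_mult_left)
  also have "(?a * ?b) * (u * (?a * ?a)) = (u * ?b) * ?a ^ 3" by (simp add: power3_eq_cube mult_ac)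
  also have "[\<dots> = (u * ?b) * 1] (ideal ?P)" using cubed(1) by (rule ideal_cong_mult_left)
  finally show ?thesis by simp
qed

lemma euler_cubic_inertD:
  assumes "prime p" "p mod 3 = 2" and coprime: "coprime (int p) (eis_norm z)"
    and euler: "euler_cubic p z u"
  shows "[eis_cnj z ^ (p div 3 + 1) = u * z ^ (p div 3 + 1)] (ideal {of_nat p})"
proof (rule ideal_cong_eis_mult_cancel)
  let ?P = "{of_nat p} :: eis set" and ?E = "euler_exponent (int p)"
  let ?a = "z ^ (p div 3 + 1)" and ?b = "eis_cnj z ^ (p div 3 + 1)"
  note cubed = power_third_cubed_inert[OF assms(1,2)]
    and E = power_euler_exponent_inert[OF assms(1,2)]
  have "[?a * ?a = eis_cnj z ^ ?E * ?b * ?a] (ideal ?P)"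
    using ideal_cong_mult_right[OF ideal_cong_sym[OF E[of "eis_cnj z"]], of ?a] by simp
  also have "eis_cnj z ^ ?E * ?b * ?a = eis_cnj z ^ ?E * (?a * ?b)" by (simp only: mult_ac)
  also have "[\<dots> = (u * z ^ ?E) * (?a * ?b)] (ideal ?P)"
    using euler unfolding euler_cubic_def by (rule ideal_cong_mult_right)
  also have "(u * z ^ ?E) * (?a * ?b) = u * ?b * (z ^ ?E * ?a)" by (simp only: mult_ac)
  also have "[\<dots> = u * ?b * ?b] (ideal ?P)" by (intro ideal_cong_mult_left E)
  finally have square: "[?a * ?a = u * ?b * ?b] (ideal ?P)" .
  have "(?b * ?b) * ?b = ?b ^ 3" by (simp only: power3_eq_cube)
  also have "[\<dots> = eis_cnj z * eis_cnj (eis_cnj z)] (ideal ?P)" by (rule cubed)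
  also have "eis_cnj z * eis_cnj (eis_cnj z) = z * eis_cnj z" by simp
  also have "[\<dots> = ?a ^ 3] (ideal ?P)" by (rule ideal_cong_sym[OF cubed])
  also have "?a ^ 3 = (?a * ?a) * ?a" by (simp add: power3_eq_cube)
  also have "[\<dots> = (u * ?b * ?b) * ?a] (ideal ?P)" using square by (rule ideal_cong_mult_right)
  also have "(u * ?b * ?b) * ?a = (?b * ?b) * (u * ?a)" by (simp only: mult_ac)
  finally show "[(?b * ?b) * ?b = (?b * ?b) * (u * ?a)] (ideal ?P)" .
qed (simp add: coprime)

lemma euler_cubic_odd_power_sum:
  assumes "prime p" "p \<noteq> 3" and coprime: "coprime (int p) (eis_norm z)"
    and euler: "euler_cubic p z u" and n: "n = p div 3"
  shows "[z ^ (2 * n + 1) + eis_cnj z ^ (2 * n + 1) =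
    (z * eis_cnj z) ^ n * (u * z + eis_cnj (u * z))] (ideal {of_nat p})"
proof -
  let ?P = "{of_nat p} :: eis set" and ?w = "eis_cnj z"
  have odd_power: "t ^ (2 * n + 1) = t ^ n * t ^ (n + 1)" for t :: eis
    by (simp add: mult_2 power_add)
  have "[z ^ (2 * n + 1) = (z * ?w) ^ n * (u * z)] (ideal ?P) \<or>
      [?w ^ (2 * n + 1) = (z * ?w) ^ n * (u * z)] (ideal ?P)"
    using assms(1,2)
  proof (cases rule: prime_mod_3_cases)
    case split
    have "[z ^ n * z ^ (n + 1) = (u * ?w ^ n) * z ^ (n + 1)] (ideal ?P)"
      unfolding n by (intro ideal_cong_mult_right euler_cubic_splitD assms split)
    then show ?thesis unfolding odd_power by (simp add: power_mult_distrib mult_ac)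
  next
    case inert
    have "[?w ^ n * ?w ^ (n + 1) = ?w ^ n * (u * z ^ (n + 1))] (ideal ?P)"
      unfolding n by (intro ideal_cong_mult_left euler_cubic_inertD assms inert)
    then show ?thesis unfolding odd_power by (simp add: power_mult_distrib mult_ac)
  qed
  then show ?thesis
  proof
    assume "[z ^ (2 * n + 1) = (z * ?w) ^ n * (u * z)] (ideal ?P)"
    from ideal_cong_add[OF this ideal_cong_eis_cnj[OF this]] show ?thesis
      by (simp add: distrib_left mult.commute[of ?w z])
  next
    assume "[?w ^ (2 * n + 1) = (z * ?w) ^ n * (u * z)] (ideal ?P)"
    from ideal_cong_add[OF ideal_cong_eis_cnj[OF this] this] show ?thesis
      by (simp add: distrib_left mult.commute[of ?w z] add.commute)
  qed
qed

theorem morgan_voyce_euler_cubic: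
  assumes "prime p" "p \<noteq> 3" and "coprime (int p) (eis_norm z)" and "euler_cubic p z u"
    and roots: "[z\<^sup>2 + (eis_cnj z)\<^sup>2 = (x + 2) * (z * eis_cnj z)] (ideal {of_nat p})"
  shows "[morgan_voyce (p div 3) x * (z + eis_cnj z) = u * z + eis_cnj (u * z)] (ideal {of_nat p})"
proof (rule ideal_cong_eis_mult_cancel)
  let ?P = "{of_nat p} :: eis set" and ?n = "p div 3" and ?w = "eis_cnj z"
  have "(z * ?w) ^ ?n * (morgan_voyce ?n x * (z + ?w)) =
      morgan_voyce ?n x * (z * ?w) ^ ?n * (z + ?w)"
    by (simp only: mult_ac)
  also have "[\<dots> = z ^ (2 * ?n + 1) + ?w ^ (2 * ?n + 1)] (ideal ?P)"
    using roots by (rule morgan_voyce_closed_form)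
  also have "[\<dots> = (z * ?w) ^ ?n * (u * z + eis_cnj (u * z))] (ideal ?P)"
    using assms(1-4) refl by (rule euler_cubic_odd_power_sum)
  finally show "[(z * ?w) ^ ?n * (morgan_voyce ?n x * (z + ?w)) =
      (z * ?w) ^ ?n * (u * z + eis_cnj (u * z))] (ideal ?P)" .
qed (simp add: assms(3))

section \<open>Primes represented by forms of discriminant \<open>-279\<close>\<close>

lemma binary_form_complete_square:
  fixes A B C x y :: int
  shows "4 * A * (A * x\<^sup>2 + B * x * y + C * y\<^sup>2) = (2 * A * x + B * y)\<^sup>2 + (4 * A * C - B\<^sup>2) * y\<^sup>2"
  by (simp add: power2_eq_square algebra_simps)

lemma binary_form_snd_eq_0:
  fixes A B C x y :: int
  assumes "4 * A * (A * x\<^sup>2 + B * x * y + C * y\<^sup>2) < 4 * A * C - B\<^sup>2" and "4 * A * C - B\<^sup>2 > 0"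
  shows "y = 0"
proof (rule ccontr)
  define d where "d = 4 * A * C - B\<^sup>2"
  assume "y \<noteq> 0"
  then have "y\<^sup>2 \<ge> 1" by (simp add: int_one_le_iff_zero_less)
  then have "d * 1 \<le> d * y\<^sup>2" using assms(2) unfolding d_def by (intro mult_left_mono) simp_all
  moreover have "(2 * A * x + B * y)\<^sup>2 + d * y\<^sup>2 < d"
    using assms(1) unfolding binary_form_complete_square d_def .
  moreover have "(2 * A * x + B * y)\<^sup>2 \<ge> 0" by simp
  ultimately show False by linarith
qed

lemma prime_dvd_snd_binary_form:
  fixes p A B C x y :: int
  assumes "prime p" and form: "p = A * x\<^sup>2 + B * x * y + C * y\<^sup>2" and y: "p dvd y"
  shows "p dvd A"
proof (rule ccontr)
  assume "\<not> p dvd A"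
  have "p dvd p - (B * x + C * y) * y" using y by (intro dvd_diff dvd_mult) simp_all
  also have "p - (B * x + C * y) * y = A * x\<^sup>2"
    using form by (simp add: algebra_simps power2_eq_square)
  finally have "p dvd x\<^sup>2" using \<open>\<not> p dvd A\<close> assms(1) by (simp add: prime_dvd_mult_iff)
  with assms(1) have x: "p dvd x" by (rule prime_dvd_power)
  have "p * p dvd A * (x * x) + B * (x * y) + C * (y * y)"
    using x y by (intro dvd_add dvd_mult mult_dvd_mono)
  also have "\<dots> = p * 1" using form by (simp add: power2_eq_square mult.assoc)
  finally have "p dvd 1" using assms(1) by (subst (asm) dvd_mult_cancel_left) auto
  then show False using assms(1) by auto
qed

lemma prime_dvd_prime_iff:
  assumes "prime p" and "prime q"
  shows "int p dvd int q \<longleftrightarrow> p = q"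
  using primes_dvd_imp_eq[OF assms] by auto

lemma prime_dvd_numeral_iff:
  assumes "prime p" and "prime (numeral n :: nat)"
  shows "int p dvd numeral n \<longleftrightarrow> p = numeral n"
  using prime_dvd_prime_iff[OF assms] by simp

lemma cong_quotientI:
  assumes "coprime b m" and "[s * b = a] (mod m)"
  shows "cong_quotient s a b m"
proof -
  have "[s * 1 = s * (b * modular_inverse m b)] (mod m)"
    using assms(1) by (intro cong_mult cong_refl cong_sym[OF cong_modular_inverse1])
  also have "s * (b * modular_inverse m b) = (s * b) * modular_inverse m b"
    by (simp only: mult.assoc)
  also have "[\<dots> = a * modular_inverse m b] (mod m)" using assms(2) by (intro cong_mult cong_refl)
  finally show ?thesis using assms(1) by (simp add: cong_quotient_def)
qed

lemma cong_quotient_cong: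
  "[s = t] (mod m) \<Longrightarrow> cong_quotient t a b m \<Longrightarrow> cong_quotient s a b m"
  unfolding cong_quotient_def by (blast intro: cong_trans)

text \<open>
  The forms of discriminant \<open>-279\<close> whose middle coefficient is written \<open>2 h + 9\<close>. The norm of \<open>z\<close> is
  \<open>A p - 9 Y\<^sup>2\<close>, so that \<open>(A/z)\<^sub>3 (p/z)\<^sub>3 = (3Y/z)\<^sub>3\<^sup>2\<close>, and modulo \<open>p\<close> the quotient of \<open>z\<close> and its
  conjugate is a root of \<open>t\<^sup>2 - 29 t + 1\<close>.
\<close>

locale form_279 =
  fixes p :: nat and A h C X Y :: int
  assumes prime_p: "prime p" and p_gt_3: "p > 3" and p_neq_31: "p \<noteq> 31"
    and form: "int p = A * X\<^sup>2 + (2 * h + 9) * X * Y + C * Y\<^sup>2"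
    and disc: "A * C = h\<^sup>2 + 9 * h + 90"
    and not_3_dvd: "\<not> 3 dvd A" and not_p_dvd: "\<not> int p dvd A"
begin

definition z :: eis where "z = Eis (A * X + h * Y) (- 9 * Y)"

lemma z_sel [simp]: "eis_fst z = A * X + h * Y" "eis_snd z = - 9 * Y"
  by (simp_all add: z_def)

lemma prime_int_p: "prime (int p)"
  using prime_p by simp

lemma not_p_dvd_Y: "\<not> int p dvd Y"
  using prime_dvd_snd_binary_form[OF prime_int_p form] not_p_dvd by blast

lemma eis_norm_z: "eis_norm z = A * int p - 9 * Y\<^sup>2"
proof -
  have "eis_norm z = A * (A * X\<^sup>2 + (2 * h + 9) * X * Y) + (h\<^sup>2 + 9 * h + 90) * Y\<^sup>2 - 9 * Y\<^sup>2"
    by (simp add: eis_norm_def power2_eq_square algebra_simps)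
  then show ?thesis unfolding disc [symmetric] form by (simp add: algebra_simps)
qed

lemma coprime_Y: "coprime Y (A * int p)"
proof (rule ccontr)
  assume "\<not> coprime Y (A * int p)"
  then obtain c where c: "c dvd Y" "c dvd A * int p" "\<not> is_unit c" by (rule not_coprimeE)
  moreover have "c \<noteq> 0" using c(1) not_p_dvd_Y by auto
  ultimately obtain d where "prime d" "d dvd c" using prime_divisor_exists by blast
  with c have d: "prime d" "d dvd Y" "d dvd A * int p" using dvd_trans by blast+
  have "d dvd int p" if "d dvd A"
    unfolding form by (intro dvd_add) (use that d(2) in \<open>simp_all add: power2_eq_square\<close>)
  then have "d dvd int p" using d(1,3) by (auto simp: prime_dvd_mult_iff)
  then have "d = int p" using d(1) prime_int_p by (simp add: primes_dvd_imp_eq)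
  then show False using d(2) not_p_dvd_Y by simp
qed

lemma coprime_3_Y: "coprime (3 * Y) (A * int p)"
proof -
  have "\<not> 3 dvd int p" using p_gt_3 primes_dvd_imp_eq[of 3 "int p"] prime_int_p by auto
  then have "\<not> 3 dvd A * int p" using not_3_dvd by (simp add: prime_dvd_mult_iff)
  then have "coprime 3 (A * int p)" by (intro prime_imp_coprime) simp_all
  then show ?thesis using coprime_Y by simp
qed

lemma coprime_3_Y_norm: "coprime (3 * Y) (eis_norm z)"
proof -
  have "[A * int p = eis_norm z] (mod 3 * Y)"
    by (simp add: eis_norm_z cong_iff_dvd_diff power2_eq_square)
  with coprime_3_Y show ?thesis by (metis cong_imp_coprime coprime_commute)
qed

lemma coprime_A_p_norm: "coprime (A * int p) (eis_norm z)"
proof -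
  have "[- ((3 * Y)\<^sup>2) = eis_norm z] (mod A * int p)"
    by (simp add: eis_norm_z cong_iff_dvd_diff power_mult_distrib)
  moreover have "coprime (- ((3 * Y)\<^sup>2)) (A * int p)"
    using coprime_3_Y by (simp only: coprime_minus_left_iff coprime_power_left_iff simp_thms)
  ultimately show ?thesis by (metis cong_imp_coprime coprime_commute)
qed

lemma coprime_p_norm: "coprime (int p) (eis_norm z)"
  using coprime_A_p_norm by simp

lemma primary_z: "primary z"
proof -
  have "\<not> 3 dvd eis_fst z"
  proof
    assume "3 dvd eis_fst z"
    then have "3 dvd eis_norm z" by (auto simp: eis_norm_def power2_eq_square)
    with coprime_3_Y_norm have "(3 :: int) dvd 1" by (metis coprime_def dvd_triv_left)
    then show False by simp
  qed
  then show ?thesis by (simp add: primary_def)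
qed

definition symbol :: "int \<Rightarrow> eis" where
  "symbol = (SOME f. cubic_symbol z f)"

sublocale cubic_symbol z symbol
  unfolding symbol_def using cubic_symbol_exists[OF primary_z] by (rule someI_ex)

lemma symbol_A_times_p: "symbol A * symbol (int p) = 1"
proof -
  have "coprime (3 ^ 3 * (3 * Y)\<^sup>2) (eis_norm z)"
    using coprime_3_Y_norm
    by (simp only: coprime_mult_left_iff coprime_power_left_iff simp_thms)
  moreover have "3 ^ 3 * (3 * Y)\<^sup>2 = 3 * (eis_snd z)\<^sup>2" by (simp add: power_mult_distrib)
  ultimately have "symbol (3 ^ 3 * (3 * Y)\<^sup>2) = 1"
    using primary_z symbol_3_times_square by (simp add: primary_def)
  moreover have "symbol 3 ^ 3 = 1"
    using coprime_3_Y_norm by (intro cube_roots_cubed symbol_in_cube_roots) simp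
  ultimately have "symbol ((3 * Y)\<^sup>2) = 1" by (simp only: symbol_mult symbol_power) simp
  moreover have "symbol (A * int p) = symbol ((3 * Y)\<^sup>2)"
    by (rule symbol_cong) (simp add: eis_norm_z cong_iff_dvd_diff power_mult_distrib)
  ultimately show ?thesis by (simp add: symbol_mult)
qed

lemma symbol_p: "symbol (int p) = (symbol A)\<^sup>2"
proof -
  have "symbol A ^ 3 = 1"
    using coprime_A_p_norm by (intro cube_roots_cubed symbol_in_cube_roots) simp
  then have "symbol (int p) = (symbol A)\<^sup>2 * (symbol A * symbol (int p))"
    by (simp add: power2_eq_square power3_eq_cube mult_ac)
  then show ?thesis by (simp add: symbol_A_times_p)
qed

text \<open>Modulo a divisor of \<open>A\<close> the number \<open>z\<close> is a rational multiple of \<open>h - 9 \<omega>\<close>.\<close>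

lemma symbol_prime_divisor:
  assumes "prime l" "int l dvd A" and "u \<in> cube_roots" and "euler_cubic l (Eis h (- 9)) u"
  shows "symbol (int l) = u"
proof (rule symbol_eqI)
  show "coprime (int l) (eis_norm z)"
    using coprime_A_p_norm coprime_divisors[of "int l" A "eis_norm z" "eis_norm z"] assms(2) by simp
  show "l \<noteq> 3" using assms(2) not_3_dvd by auto
  have "euler_cubic l (of_int Y * Eis h (- 9)) (1 * u)"
    using euler_cubic_of_int assms(4) by (rule euler_cubic_mult)
  moreover have "[z = of_int Y * Eis h (- 9)] (ideal {of_nat l})"
    using assms(2) by (simp add: ideal_cong_eis_iff cong_iff_dvd_diff)
  ultimately show "euler_cubic l z u" using euler_cubic_cong by simp
qed (use assms in simp_all)

lemma eis_trace_z: "eis_trace z = 2 * A * X + (2 * h + 9) * Y"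
  by (simp add: eis_trace_def algebra_simps)

lemma coprime_trace_z: "coprime (eis_trace z) (int p)"
  unfolding coprime_prime_iff[OF prime_p]
proof
  assume "int p dvd eis_trace z"
  then have "int p dvd 4 * A * int p - (eis_trace z)\<^sup>2" by (simp add: power2_eq_square)
  also have "4 * A * int p - (eis_trace z)\<^sup>2 = (4 * (A * C) - (2 * h + 9)\<^sup>2) * Y\<^sup>2"
    unfolding form eis_trace_z binary_form_complete_square by simp
  also have "4 * (A * C) - (2 * h + 9)\<^sup>2 = 3 * (3 * 31)"
    unfolding disc by (simp add: algebra_simps power2_eq_square)
  finally have "int p dvd 3 \<or> int p dvd 31 \<or> int p dvd Y"
    using prime_int_p by (auto simp only: prime_dvd_mult_iff intro: prime_dvd_power)
  then show False
    using p_gt_3 p_neq_31 not_p_dvd_Y by (simp add: prime_dvd_numeral_iff[OF prime_p])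
qed

lemma coprime_31_Y: "coprime (31 * Y) (int p)"
proof -
  have "\<not> int p dvd 31" using p_neq_31 by (simp add: prime_dvd_numeral_iff[OF prime_p])
  then show ?thesis
    using not_p_dvd_Y prime_int_p by (simp add: coprime_prime_iff[OF prime_p] prime_dvd_mult_iff)
qed

lemma morgan_voyce_times_trace:
  "[morgan_voyce (p div 3) 27 * eis_trace z = eis_trace (symbol (int p) * z)] (mod int p)"
proof -
  let ?P = "{of_nat p} :: eis set" and ?w = "eis_cnj z"
  have "z\<^sup>2 + ?w\<^sup>2 - (27 + 2) * (z * ?w) = (z + ?w)\<^sup>2 - 31 * (z * ?w)"
    by (simp add: power2_eq_square algebra_simps)
  also have "\<dots> = of_int ((eis_trace z)\<^sup>2 - 31 * eis_norm z)"
    unfolding eis_mult_cnj eis_add_cnj by simp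
  also have "(eis_trace z)\<^sup>2 - 31 * eis_norm z = - 27 * (eis_norm z + 9 * Y\<^sup>2)"
    by (simp add: eis_norm_def eis_trace_def power2_eq_square algebra_simps)
  also have "\<dots> = int p * (- 27 * A)" by (simp add: eis_norm_z)
  finally have "[z\<^sup>2 + ?w\<^sup>2 = (27 + 2) * (z * ?w)] (ideal ?P)"
    by (simp add: ideal_cong_singleton_iff)
  moreover have "p \<noteq> 3" using p_gt_3 by simp
  ultimately have "[morgan_voyce (p div 3) 27 * (z + ?w) =
      symbol (int p) * z + eis_cnj (symbol (int p) * z)] (ideal ?P)"
    by (intro morgan_voyce_euler_cubic euler_cubic_symbol prime_p coprime_p_norm)
  then have "[of_int (morgan_voyce (p div 3) 27) * of_int (eis_trace z) =
      of_int (eis_trace (symbol (int p) * z))] (ideal ?P)"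
    unfolding eis_add_cnj by (simp add: of_int_morgan_voyce algebra_simps)
  then show ?thesis by (simp only: ideal_cong_of_int_eis_iff flip: of_int_mult)
qed

lemma cong_if_cong_times_trace:
  "[s * eis_trace z = t * eis_trace z] (mod int p) \<Longrightarrow> [s = t] (mod int p)"
  using coprime_trace_z by (simp add: cong_mult_rcancel)

theorem morgan_voyce_if_symbol_1:
  assumes "symbol A = 1"
  shows "[morgan_voyce (p div 3) 27 = 1] (mod int p)"
proof (rule cong_if_cong_times_trace)
  have "symbol (int p) = 1" by (simp add: symbol_p assms)
  then show "[morgan_voyce (p div 3) 27 * eis_trace z = 1 * eis_trace z] (mod int p)"
    using morgan_voyce_times_trace by simp
qed

lemma cong_quotient_if_times_trace:
  assumes "[s * eis_trace z = t] (mod int p)" and "int p dvd 31 * Y * t - a * eis_trace z"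
  shows "cong_quotient s a (31 * Y) (int p)"
proof (rule cong_quotientI[OF coprime_31_Y], rule cong_if_cong_times_trace)
  have "s * (31 * Y) * eis_trace z = 31 * Y * (s * eis_trace z)" by (simp only: mult_ac)
  also have "[31 * Y * (s * eis_trace z) = 31 * Y * t] (mod int p)"
    using assms(1) by (intro cong_mult cong_refl)
  also have "[31 * Y * t = a * eis_trace z] (mod int p)"
    using assms(2) by (simp only: cong_iff_dvd_diff)
  finally show "[s * (31 * Y) * eis_trace z = a * eis_trace z] (mod int p)" .
qed

lemma mult_A_p_eq:
  "c * A * int p = c * (A * (A * X\<^sup>2 + (2 * h + 9) * X * Y) + (h\<^sup>2 + 9 * h + 90) * Y\<^sup>2)"
  unfolding disc [symmetric] form by (simp add: algebra_simps)

theorem morgan_voyce_if_symbol_omega: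
  assumes "symbol A = \<omega>"
  shows "cong_quotient (morgan_voyce (p div 3) 27) (3 * A * X + (3 * h - 2) * Y) (31 * Y) (int p)"
proof (rule cong_quotient_if_times_trace[OF morgan_voyce_times_trace])
  have "eis_trace (symbol (int p) * z) = - (A * X + (h + 18) * Y)"
    by (simp add: symbol_p assms eis_trace_def power2_eq_square algebra_simps)
  moreover have "31 * Y * - (A * X + (h + 18) * Y) - (3 * A * X + (3 * h - 2) * Y) * eis_trace z =
      - 6 * A * int p"
    unfolding mult_A_p_eq eis_trace_z by (simp add: power2_eq_square algebra_simps)
  ultimately show "int p dvd 31 * Y * eis_trace (symbol (int p) * z)
      - (3 * A * X + (3 * h - 2) * Y) * eis_trace z"
    by simp
qed

theorem morgan_voyce_if_symbol_omega_square:
  assumes "symbol A = \<omega>\<^sup>2"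
  shows "cong_quotient (morgan_voyce (p div 3) 27) (- (3 * A * X + (3 * h + 29) * Y)) (31 * Y)
    (int p)"
proof (rule cong_quotient_if_times_trace[OF morgan_voyce_times_trace])
  have "symbol (int p) = \<omega>" using symbol_p assms by (simp add: eis_eq_iff power2_eq_square)
  then have "eis_trace (symbol (int p) * z) = - (A * X + (h - 9) * Y)"
    by (simp add: eis_trace_def algebra_simps)
  moreover have "31 * Y * - (A * X + (h - 9) * Y) - - (3 * A * X + (3 * h + 29) * Y) * eis_trace z =
      6 * A * int p"
    unfolding mult_A_p_eq eis_trace_z by (simp add: power2_eq_square algebra_simps)
  ultimately show "int p dvd 31 * Y * eis_trace (symbol (int p) * z)
      - - (3 * A * X + (3 * h + 29) * Y) * eis_trace z"
    by simp
qed

end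

lemma euler_cubic_2:
  assumes "even h"
  shows "euler_cubic 2 (Eis h (- 9)) \<omega>"
proof (rule euler_cubic_inertI)
  show "[eis_cnj (Eis h (- 9)) ^ (2 div 3 + 1) = \<omega> * Eis h (- 9) ^ (2 div 3 + 1)]
      (ideal {of_nat 2})"
    using assms by (simp add: ideal_cong_eis_numeral_iff cong_iff_dvd_diff)
qed (simp_all add: cube_roots_def)

lemma euler_cubic_5: "euler_cubic 5 (Eis 0 (- 9)) (\<omega>\<^sup>2)" "euler_cubic 5 (Eis (- 4) (- 9)) \<omega>"
  by (rule euler_cubic_inertI;
      simp add: cube_roots_def ideal_cong_eis_numeral_iff cong_def power2_eq_square)+

lemma euler_cubic_7: "euler_cubic 7 (Eis (- 4) (- 9)) \<omega>"
  by (rule euler_cubic_splitI;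
      simp add: cube_roots_def ideal_cong_eis_numeral_iff cong_def power2_eq_square)

lemma euler_cubic_19: "euler_cubic 19 (Eis (- 2) (- 9)) \<omega>"
proof (rule euler_cubic_splitI)
  have "x ^ (19 div 3) = (x\<^sup>2) ^ 3" for x :: eis by (simp flip: power_mult)
  then show "[Eis (- 2) (- 9) ^ (19 div 3) = \<omega> * eis_cnj (Eis (- 2) (- 9)) ^ (19 div 3)]
      (ideal {of_nat 19})"
    by (simp only: of_nat_numeral ideal_cong_eis_numeral_iff)
       (simp add: cong_def eis_cnj_def times_eis_def power2_eq_square power3_eq_cube)
qed (simp_all add: cube_roots_def)

lemma morgan_voyce_form_1_1_70:
  assumes "prime p" "p > 3" "p \<noteq> 31" and "int p = x\<^sup>2 + x * y + 70 * y\<^sup>2"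
  shows "[morgan_voyce (p div 3) 27 = 1] (mod int p)"
proof -
  interpret form_279 p 1 "- 4" 70 x y
    by unfold_locales (use assms in simp_all)
  show ?thesis by (rule morgan_voyce_if_symbol_1) (rule symbol_1)
qed

lemma morgan_voyce_form_9_9_10:
  assumes "prime p" "p > 3" "p \<noteq> 31" and form: "int p = 9 * x\<^sup>2 + 9 * x * y + 10 * y\<^sup>2"
  shows "[morgan_voyce (p div 3) 27 = 1] (mod int p)"
proof -
  have form': "int p = 10 * y\<^sup>2 + 9 * y * x + 9 * x\<^sup>2" using form by (simp add: algebra_simps)
  have "p \<noteq> 5"
  proof
    assume "p = 5"
    then have "x = 0" using binary_form_snd_eq_0[of 10 y 9 x 9] form' by simp
    with form \<open>p = 5\<close> show False by simp presburger
  qed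
  then have "\<not> int p dvd 2 * 5"
    using assms(1,2) prime_dvd_mult_iff[of "int p" 2 5] by (simp add: prime_dvd_numeral_iff)
  then interpret form_279 p 10 0 9 y x
  proof unfold_locales
    show "int p = 10 * y\<^sup>2 + (2 * 0 + 9) * y * x + 9 * x\<^sup>2" using form' by simp
  qed (use assms(1-3) in simp_all)
  have "symbol (int 2) = \<omega>" "symbol (int 5) = \<omega>\<^sup>2"
    by (rule symbol_prime_divisor; simp add: cube_roots_def euler_cubic_2 euler_cubic_5)+
  then have "symbol 10 = \<omega> ^ 3"
    using symbol_mult[of 2 5] by (simp add: power2_eq_square power3_eq_cube)
  then show ?thesis by (intro morgan_voyce_if_symbol_1) (simp add: eis_omega_cubed)
qed

lemma morgan_voyce_form_8_3_9:
  assumes "prime p" "p > 3" "p \<noteq> 31" and "int p = 8 * x\<^sup>2 + 3 * x * y + 9 * y\<^sup>2"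
  shows "[morgan_voyce (p div 3) 27 = 1] (mod int p)"
proof -
  have "\<not> int p dvd 2 ^ 3"
    using assms(1,2) prime_dvd_power[of "int p" 2 3] by (auto simp: prime_dvd_numeral_iff)
  then interpret form_279 p 8 "- 3" 9 x y
    by unfold_locales (use assms in simp_all)
  have "coprime (2 * 4) (eis_norm z)" using coprime_A_p_norm by simp
  then have "symbol 2 \<in> cube_roots"
    by (intro symbol_in_cube_roots) (simp only: coprime_mult_left_iff)
  then have "symbol (2 ^ 3) = 1" by (simp only: symbol_power cube_roots_cubed)
  then show ?thesis by (intro morgan_voyce_if_symbol_1) simp
qed

lemma morgan_voyce_form_prime_coeff:
  assumes p: "prime p" "p > 3" "p \<noteq> 31" and l: "prime l" "l \<noteq> 3" "p \<noteq> l"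
    and "int p = int l * x\<^sup>2 + (2 * h + 9) * x * y + C * y\<^sup>2" and "int l * C = h\<^sup>2 + 9 * h + 90"
    and euler: "euler_cubic l (Eis h (- 9)) \<omega>"
  shows "cong_quotient (morgan_voyce (p div 3) 27) (3 * int l * x + (3 * h - 2) * y) (31 * y)
    (int p)"
proof -
  interpret form_279 p "int l" h C x y
  proof
    show "\<not> 3 dvd int l" using l(1,2) prime_dvd_prime_iff[of 3 l] by simp
    show "\<not> int p dvd int l" using prime_dvd_prime_iff[OF p(1) l(1)] l(3) by blast
  qed fact+
  have "symbol (int l) = \<omega>"
    using l(1) dvd_refl _ euler by (rule symbol_prime_divisor) (simp add: cube_roots_def)
  then show ?thesis by (rule morgan_voyce_if_symbol_omega)
qed

lemma morgan_voyce_form_5_1_14: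
  assumes "prime p" "p > 3" "p \<noteq> 31" "p \<noteq> 5" and "int p = 5 * x\<^sup>2 + x * y + 14 * y\<^sup>2"
  shows "cong_quotient (morgan_voyce (p div 3) 27) (15 * x - 14 * y) (31 * y) (int p)"
  using morgan_voyce_form_prime_coeff[of p 5 x "- 4" y 14] euler_cubic_5(2) assms by simp

lemma morgan_voyce_form_7_1_10:
  assumes "prime p" "p > 3" "p \<noteq> 31" "p \<noteq> 7" and "int p = 7 * x\<^sup>2 + x * y + 10 * y\<^sup>2"
  shows "cong_quotient (morgan_voyce (p div 3) 27) (21 * x - 14 * y) (31 * y) (int p)"
  using morgan_voyce_form_prime_coeff[of p 7 x "- 4" y 10] euler_cubic_7 assms by simp

lemma morgan_voyce_form_19_5_4:
  assumes "prime p" "p > 3" "p \<noteq> 31" "p \<noteq> 19" and "int p = 19 * x\<^sup>2 + 5 * x * y + 4 * y\<^sup>2"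
  shows "cong_quotient (morgan_voyce (p div 3) 27) (57 * x - 8 * y) (31 * y) (int p)"
  using morgan_voyce_form_prime_coeff[of p 19 x "- 2" y 4] euler_cubic_19 assms by simp

lemma morgan_voyce_form_35_1_2:
  assumes "prime p" "p > 3" "p \<noteq> 31" and form: "int p = 35 * x\<^sup>2 + x * y + 2 * y\<^sup>2"
  shows "cong_quotient (morgan_voyce (p div 3) 27) (- (105 * x + 17 * y)) (31 * y) (int p)"
proof -
  have "\<not> (p = 5 \<or> p = 7)"
  proof
    assume p: "p = 5 \<or> p = 7"
    have form': "int p = 2 * y\<^sup>2 + 1 * y * x + 35 * x\<^sup>2" using form by (simp add: algebra_simps)
    then have "x = 0" using binary_form_snd_eq_0[of 2 y 1 x 35] p by auto
    with form p show False by auto presburger+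
  qed
  then have "\<not> int p dvd 5 * 7"
    using assms(1) prime_dvd_mult_iff[of "int p" 5 7] by (simp add: prime_dvd_numeral_iff)
  then interpret form_279 p 35 "- 4" 2 x y
    by unfold_locales (use assms in simp_all)
  have "symbol (int 5) = \<omega>" "symbol (int 7) = \<omega>"
    by (rule symbol_prime_divisor; simp add: cube_roots_def euler_cubic_5 euler_cubic_7)+
  then have "symbol 35 = \<omega>\<^sup>2" using symbol_mult[of 5 7] by (simp add: power2_eq_square)
  then show ?thesis using morgan_voyce_if_symbol_omega_square by simp
qed

theorem theorem3p9:
  fixes p :: nat and S :: int
  assumes "prime p" and "p > 3" and "Legendre (int p) 31 = 1"
  defines "S \<equiv> (\<Sum>k=0..p div 3. int ((3 * k) choose k) * (-1) ^ k)"
  shows "\<forall>x y :: int.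
     (int p = x\<^sup>2 + x * y + 70 * y\<^sup>2 \<or> int p = 9 * x\<^sup>2 + 9 * x * y + 10 * y\<^sup>2 \<or>
      int p = 8 * x\<^sup>2 + 3 * x * y + 9 * y\<^sup>2 \<longrightarrow> [S = 1] (mod int p)) \<and>
     (int p = 5 * x\<^sup>2 + x * y + 14 * y\<^sup>2 \<and> p \<noteq> 5 \<longrightarrow>
        cong_quotient S (15 * x - 14 * y) (31 * y) (int p)) \<and>
     (int p = 7 * x\<^sup>2 + x * y + 10 * y\<^sup>2 \<and> p \<noteq> 7 \<longrightarrow>
        cong_quotient S (21 * x - 14 * y) (31 * y) (int p)) \<and>
     (int p = 19 * x\<^sup>2 + 5 * x * y + 4 * y\<^sup>2 \<and> p \<noteq> 19 \<longrightarrow>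
        cong_quotient S (57 * x - 8 * y) (31 * y) (int p)) \<and>
     (int p = 35 * x\<^sup>2 + x * y + 2 * y\<^sup>2 \<longrightarrow>
        cong_quotient S (- (105 * x + 17 * y)) (31 * y) (int p))"
proof -
  have "p \<noteq> 31" using assms(3) by (auto simp: Legendre_def cong_def)
  note p = assms(1,2) this
  have S: "[S = morgan_voyce (p div 3) 27] (mod int p)"
    unfolding S_def using p(1,2) by (rule binomial_triple_sum_cong)
  note sum_eq_1 = cong_trans[OF S] and sum_eq_quotient = cong_quotient_cong[OF S]
  show ?thesis
    using sum_eq_1[OF morgan_voyce_form_1_1_70[OF p]] sum_eq_1[OF morgan_voyce_form_9_9_10[OF p]]
      sum_eq_1[OF morgan_voyce_form_8_3_9[OF p]]
      sum_eq_quotient[OF morgan_voyce_form_5_1_14[OF p]]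
      sum_eq_quotient[OF morgan_voyce_form_7_1_10[OF p]]
      sum_eq_quotient[OF morgan_voyce_form_19_5_4[OF p]]
      sum_eq_quotient[OF morgan_voyce_form_35_1_2[OF p]]
    by blast
qed

end
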